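(* Let $r\colon D\otimes D\to D\otimes D$ be a non-degenerate coalgebra automorphism whose induced map $r_{|}\colon X\times X\to X\times X$ is a non-degenerate solution of the set-theoretic braid equation. Then $r$ is a solution of the braid equation if and only if for each family of six closed intervals $[a,b]$, $[c,d]$, $[e,f]$, $[g,h]$, $[i,j]$, $[k,l]$ of $X$ (with $a\le b$, $c\le d$, $e\le f$, $g\le h$, $i\le j$, $k\le l$) such that $[g,h]\subseteq[a,b]$, $[i,j]\subseteq[c,d]$ and $[k,l]\subseteq[e,f]$, the following equality holds: $$\sum_{\substack{x\in[a,g]\\ y\in[h,b]}}\sum_{\substack{w\in[c,i]\\ z\in[j,d]}}\sum_{\substack{u\in[e,k]\\ v\in[l,f]}}\lambda_{a|b|c|d}^{{}^a w\,|\,{}^a z\,|\,x^c\,|\,y^c}\;\lambda_{x^c|y^c|e|f}^{{}^{(x^c)}u\,|\,{}^{(x^c)}v\,|\,(g^c)^e\,|\,(h^c)^e}\;\lambda_{{}^a w\,|\,{}^a z\,|\,{}^{(x^c)}u\,|\,{}^{(x^c)}v}^{{}^a({}^c k)\,|\,{}^a({}^c l)\,|\,({}^a i)^{({}^{(a^i)}e)}\,|\,({}^a j)^{({}^{(a^j)}e)}}$$ $$=\sum_{\substack{x\in[a,g]\\ y\in[h,b]}}\sum_{\substack{w\in[c,i]\\ z\in[j,d]}}\sum_{\substack{u\in[e,k]\\ v\in[l,f]}}\lambda_{c|d|e|f}^{{}^c u\,|\,{}^c v\,|\,w^e\,|\,z^e}\;\lambda_{a\,|\,b\,|\,{}^c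 u\,|\,{}^c v}^{{}^a({}^c k)\,|\,{}^a({}^c l)\,|\,x^{({}^c u)}\,|\,y^{({}^c u)}}\;\lambda_{x^{({}^c u)}\,|\,y^{({}^c u)}\,|\,w^e\,|\,z^e}^{{}^{(a^{({}^i e)})}(i^e)\,|\,{}^{(a^{({}^j e)})}(j^e)\,|\,(g^c)^e\,|\,(h^c)^e}.$$
   Context: $K$ is a field and $\otimes=\otimes_K$. $(X,\le)$ is a locally finite poset (every interval $[a,b]=\{c: a\le c\le b\}$ is finite), $Y=\{(a,b)\in X\times X: a\le b\}$, and $D=KY$ is the incidence coalgebra with $\Delta(a,b)=\sum_{c\in[a,b]}(a,c)\otimes(c,b)$, $\epsilon(a,b)=\delta_{ab}$. For a linear map $r\colon D\otimes D\to D\otimes D$ the scalars $\lambda_{a|b|c|d}^{e|f|g|h}$ are defined by $r((a,b)\otimes(c,d))=\sum_{e\le f,\ g\le h}\lambda_{a|b|c|d}^{e|f|g|h}\,(e,f)\otimes(g,h)$. A coalgebra automorphism $r$ of $D\otimes D$ is non-degenerate if, with $\sigma=(D\otimes\epsilon)\circ r$ and $\tau=(\epsilon\otimes D)\circ r$, there exist linear maps $\bar\sigma,\bar\tau\colon D\otimes D\to D$ such that $\bar\sigma\circ(D\otimes\sigma)\circ(\Delta\otimes D)=\sigma\circ(D\otimes\bar\sigma)\circ(\Delta\otimes D)=\epsilon\otimes D$ and $\bar\tau\circ(\tau\otimes D)\circ(D\otimes\Delta)=\tau\circ(\bar\tau\otimes D)\circ(D\otimes\Delta)=D\otimes\epsilon$.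 Such an $r$ sends group-like elements to group-like elements, and induces a bijection $r_{|}\colon X\times X\to X\times X$, $r_{|}(a,c)=({}^a c,a^c)$, determined by $r((a,a)\otimes(c,c))=({}^a c,{}^a c)\otimes(a^c,a^c)$; all the maps ${}^a(-)\colon X\to X$ and $(-)^c\colon X\to X$ are bijections (this is the non-degeneracy of $r_{|}$). A map $s$ (on $D\otimes D$ or on $X\times X$) is a solution of the braid equation if $s_{12}\circ s_{23}\circ s_{12}=s_{23}\circ s_{12}\circ s_{23}$, where $s_{12},s_{23}$ denote $s$ acting on the first two, respectively the last two, of three factors. *)

theory Defs
  imports "HOL-Library.Poly_Mapping" "HOL-Library.Interval"
begin

text \<open>
  The vector space with basis \<open>'b\<close> over the field \<open>'k\<close> is the type \<open>'b \<Rightarrow>\<^sub>0 'k\<close> of finitely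
  supported functions. The tensor product of the spaces with bases \<open>'b\<close> and \<open>'c\<close> is the space
  with basis \<open>'b \<times> 'c\<close>, where \<open>b \<otimes> c\<close> is the basis vector at \<open>(b, c)\<close>; the identifications
  \<open>(U \<otimes> V) \<otimes> W = U \<otimes> (V \<otimes> W)\<close> are made explicit, while \<open>V \<otimes> K\<close>, \<open>K \<otimes> V\<close> and \<open>K \<otimes> K\<close> are
  identified with \<open>V\<close>, \<open>V\<close> and \<open>K\<close>.
\<close>

definition scl :: "'k::field \<Rightarrow> ('b \<Rightarrow>\<^sub>0 'k) \<Rightarrow> ('b \<Rightarrow>\<^sub>0 'k)"
  where "scl c p = Poly_Mapping.map ((*) c) p"

lemma lookup_scl [simp]: "Poly_Mapping.lookup (scl c p) b = c * Poly_Mapping.lookup p b"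
  unfolding scl_def by (simp add: Poly_Mapping.map.rep_eq when_def)

lemma vector_space_scl: "vector_space (scl :: 'k::field \<Rightarrow> ('b \<Rightarrow>\<^sub>0 'k) \<Rightarrow> _)"
  by unfold_locales (auto intro!: poly_mapping_eqI simp: lookup_add algebra_simps)

definition bas :: "'b \<Rightarrow> ('b \<Rightarrow>\<^sub>0 'k::field)"
  where "bas b = Poly_Mapping.single b 1"

definition lin_ext :: "('k::field \<Rightarrow> 'v::ab_group_add \<Rightarrow> 'v) \<Rightarrow> ('b \<Rightarrow> 'v) \<Rightarrow> ('b \<Rightarrow>\<^sub>0 'k) \<Rightarrow> 'v"
  where "lin_ext s f p = (\<Sum>b\<in>Poly_Mapping.keys p. s (Poly_Mapping.lookup p b) (f b))"

abbreviation is_linear :: "(('b \<Rightarrow>\<^sub>0 'k::field) \<Rightarrow> ('c \<Rightarrow>\<^sub>0 'k)) \<Rightarrow> bool"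
  where "is_linear \<equiv> Vector_Spaces.linear scl scl"

lemma lin_ext_bas:
  assumes "vector_space s" shows "lin_ext s f (bas b) = f b"
proof -
  interpret vector_space s by fact
  show ?thesis by (simp add: lin_ext_def bas_def)
qed

lemma linear_lin_ext:
  assumes "vector_space s" shows "Vector_Spaces.linear scl s (lin_ext s f)"
proof -
  interpret S: vector_space s by fact
  interpret V: vector_space "scl :: 'a \<Rightarrow> ('c \<Rightarrow>\<^sub>0 'a) \<Rightarrow> _" by (rule vector_space_scl)
  have ext: "lin_ext s f p = (\<Sum>b\<in>B. s (Poly_Mapping.lookup p b) (f b))"
    if "finite B" "Poly_Mapping.keys p \<subseteq> B" for p B
    unfolding lin_ext_def
    by (rule sum.mono_neutral_left) (use that in \<open>auto simp: in_keys_iff\<close>)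
  have add: "lin_ext s f (p + q) = lin_ext s f p + lin_ext s f q" for p q
  proof -
    let ?B = "Poly_Mapping.keys p \<union> Poly_Mapping.keys q"
    show ?thesis
      using Poly_Mapping.keys_add[of p q]
      by (simp add: ext[of ?B] lookup_add S.scale_left_distrib sum.distrib)
  qed
  have "lin_ext s f (scl c p) = s c (lin_ext s f p)" for c p
  proof -
    have "Poly_Mapping.keys (scl c p) \<subseteq> Poly_Mapping.keys p" by (auto simp: in_keys_iff)
    then show ?thesis
      by (simp add: ext[of "Poly_Mapping.keys p"] S.scale_sum_right)
  qed
  with add show ?thesis by unfold_locales auto
qed

definition pure_tensor :: "('b \<Rightarrow>\<^sub>0 'k::field) \<Rightarrow> ('c \<Rightarrow>\<^sub>0 'k) \<Rightarrow> ('b \<times> 'c \<Rightarrow>\<^sub>0 'k)"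
  where "pure_tensor p q = lin_ext scl (\<lambda>b. lin_ext scl (\<lambda>c. bas (b, c)) q) p"

definition tensor_map ::
  "(('b \<Rightarrow>\<^sub>0 'k::field) \<Rightarrow> ('c \<Rightarrow>\<^sub>0 'k)) \<Rightarrow> (('d \<Rightarrow>\<^sub>0 'k) \<Rightarrow> ('e \<Rightarrow>\<^sub>0 'k)) \<Rightarrow>
     ('b \<times> 'd \<Rightarrow>\<^sub>0 'k) \<Rightarrow> ('c \<times> 'e \<Rightarrow>\<^sub>0 'k)"
  where "tensor_map f g = lin_ext scl (\<lambda>(b, d). pure_tensor (f (bas b)) (g (bas d)))"

text \<open>The maps \<open>V \<otimes> \<phi>\<close>, \<open>\<phi> \<otimes> V\<close> and \<open>\<phi> \<otimes> \<psi>\<close> for linear forms \<open>\<phi>\<close> and \<open>\<psi>\<close>.\<close>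

definition id_tensor_form :: "(('d \<Rightarrow>\<^sub>0 'k::field) \<Rightarrow> 'k) \<Rightarrow> ('b \<times> 'd \<Rightarrow>\<^sub>0 'k) \<Rightarrow> ('b \<Rightarrow>\<^sub>0 'k)"
  where "id_tensor_form \<phi> = lin_ext scl (\<lambda>(b, d). scl (\<phi> (bas d)) (bas b))"

definition form_tensor_id :: "(('b \<Rightarrow>\<^sub>0 'k::field) \<Rightarrow> 'k) \<Rightarrow> ('b \<times> 'd \<Rightarrow>\<^sub>0 'k) \<Rightarrow> ('d \<Rightarrow>\<^sub>0 'k)"
  where "form_tensor_id \<phi> = lin_ext scl (\<lambda>(b, d). scl (\<phi> (bas b)) (bas d))"

definition form_tensor_form ::
  "(('b \<Rightarrow>\<^sub>0 'k::field) \<Rightarrow> 'k) \<Rightarrow> (('d \<Rightarrow>\<^sub>0 'k) \<Rightarrow> 'k) \<Rightarrow> ('b \<times> 'd \<Rightarrow>\<^sub>0 'k) \<Rightarrow> 'k"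
  where "form_tensor_form \<phi> \<psi> = lin_ext (*) (\<lambda>(b, d). \<phi> (bas b) * \<psi> (bas d))"

definition assoc_right :: "(('b \<times> 'c) \<times> 'd \<Rightarrow>\<^sub>0 'k::field) \<Rightarrow> ('b \<times> 'c \<times> 'd \<Rightarrow>\<^sub>0 'k)"
  where "assoc_right = lin_ext scl (\<lambda>((b, c), d). bas (b, c, d))"

definition assoc_left :: "('b \<times> 'c \<times> 'd \<Rightarrow>\<^sub>0 'k::field) \<Rightarrow> (('b \<times> 'c) \<times> 'd \<Rightarrow>\<^sub>0 'k)"
  where "assoc_left = lin_ext scl (\<lambda>(b, c, d). bas ((b, c), d))"

definition swap_middle ::
  "(('b \<times> 'c) \<times> ('d \<times> 'e) \<Rightarrow>\<^sub>0 'k::field) \<Rightarrow> (('b \<times> 'd) \<times> ('c \<times> 'e) \<Rightarrow>\<^sub>0 'k)"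
  where "swap_middle = lin_ext scl (\<lambda>((b, c), (d, e)). bas ((b, d), (c, e)))"


class locally_finite_order = order +
  assumes finite_closed_interval: "finite {a..b}"

text \<open>
  The incidence coalgebra \<open>D\<close> has basis \<open>'x interval\<close>, whose elements are the pairs \<open>(a, b)\<close> with
  \<open>a \<le> b\<close>. The term \<open>Interval (a, b)\<close> is meaningful only if \<open>a \<le> b\<close>.
\<close>

definition comul :: "('x::locally_finite_order interval \<Rightarrow>\<^sub>0 'k::field) \<Rightarrow>
    ('x interval \<times> 'x interval \<Rightarrow>\<^sub>0 'k)"
  where "comul = lin_ext scl
    (\<lambda>I. \<Sum>c\<in>{lower I..upper I}. bas (Interval (lower I, c), Interval (c, upper I)))"

definition counit :: "('x::locally_finite_order interval \<Rightarrow>\<^sub>0 'k::field) \<Rightarrow> 'k"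
  where "counit = lin_ext (*) (\<lambda>I. if lower I = upper I then 1 else 0)"

text \<open>The coalgebra structure of \<open>D \<otimes> D\<close>.\<close>

definition comul2 :: "('x::locally_finite_order interval \<times> 'x interval \<Rightarrow>\<^sub>0 'k::field) \<Rightarrow>
    (('x interval \<times> 'x interval) \<times> ('x interval \<times> 'x interval) \<Rightarrow>\<^sub>0 'k)"
  where "comul2 = swap_middle \<circ> tensor_map comul comul"

definition counit2 :: "('x::locally_finite_order interval \<times> 'x interval \<Rightarrow>\<^sub>0 'k::field) \<Rightarrow> 'k"
  where "counit2 = form_tensor_form counit counit"

type_synonym ('x, 'k) DD = "'x interval \<times> 'x interval \<Rightarrow>\<^sub>0 'k"

definition coalgebra_automorphism ::
  "(('x::locally_finite_order, 'k::field) DD \<Rightarrow> ('x, 'k) DD) \<Rightarrow> bool"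
  where "coalgebra_automorphism r \<longleftrightarrow>
    is_linear r \<and> bij r \<and> tensor_map r r \<circ> comul2 = comul2 \<circ> r \<and> counit2 \<circ> r = counit2"

definition left_part :: "(('x::locally_finite_order, 'k::field) DD \<Rightarrow> ('x, 'k) DD) \<Rightarrow>
    ('x, 'k) DD \<Rightarrow> ('x interval \<Rightarrow>\<^sub>0 'k)"
  where "left_part r = id_tensor_form counit \<circ> r"

definition right_part :: "(('x::locally_finite_order, 'k::field) DD \<Rightarrow> ('x, 'k) DD) \<Rightarrow>
    ('x, 'k) DD \<Rightarrow> ('x interval \<Rightarrow>\<^sub>0 'k)"
  where "right_part r = form_tensor_id counit \<circ> r"

definition nondegenerate :: "(('x::locally_finite_order, 'k::field) DD \<Rightarrow> ('x, 'k) DD) \<Rightarrow> bool"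
  where "nondegenerate r \<longleftrightarrow>
    (let \<sigma> = left_part r; \<tau> = right_part r;
         \<Delta>l = assoc_right \<circ> tensor_map comul id;
         \<Delta>r = assoc_left \<circ> tensor_map id comul
     in \<exists>\<sigma>' \<tau>'. is_linear \<sigma>' \<and> is_linear \<tau>' \<and>
          \<sigma>' \<circ> tensor_map id \<sigma> \<circ> \<Delta>l = form_tensor_id counit \<and>
          \<sigma> \<circ> tensor_map id \<sigma>' \<circ> \<Delta>l = form_tensor_id counit \<and>
          \<tau>' \<circ> tensor_map \<tau> id \<circ> \<Delta>r = id_tensor_form counit \<and>
          \<tau> \<circ> tensor_map \<tau>' id \<circ> \<Delta>r = id_tensor_form counit)"

text \<open>
  The map induced on \<open>'x \<times> 'x\<close>. The description is proper if \<open>r\<close> is a coalgebra automorphism,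
  because then \<open>r\<close> permutes the group-like elements \<open>(a, a) \<otimes> (c, c)\<close> of \<open>D \<otimes> D\<close>.
\<close>

definition induced_map ::
  "(('x::locally_finite_order, 'k::field) DD \<Rightarrow> ('x, 'k) DD) \<Rightarrow> 'x \<times> 'x \<Rightarrow> 'x \<times> 'x"
  where "induced_map r = (\<lambda>(a, c). THE p.
     r (bas (Interval (a, a), Interval (c, c))) =
       bas (Interval (fst p, fst p), Interval (snd p, snd p)))"

definition set_nondegenerate :: "('x \<times> 'x \<Rightarrow> 'x \<times> 'x) \<Rightarrow> bool"
  where "set_nondegenerate s \<longleftrightarrow>
    (\<forall>a. bij (\<lambda>c. fst (s (a, c)))) \<and> (\<forall>c. bij (\<lambda>a. snd (s (a, c))))"

definition set_braid :: "('x \<times> 'x \<Rightarrow> 'x \<times> 'x) \<Rightarrow> bool"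
  where "set_braid s \<longleftrightarrow>
    (let s12 = (\<lambda>(x, y, z). (fst (s (x, y)), snd (s (x, y)), z));
         s23 = (\<lambda>(x, y, z). (x, s (y, z)))
     in s12 \<circ> s23 \<circ> s12 = s23 \<circ> s12 \<circ> s23)"

definition lin_braid :: "(('b \<times> 'b \<Rightarrow>\<^sub>0 'k::field) \<Rightarrow> ('b \<times> 'b \<Rightarrow>\<^sub>0 'k)) \<Rightarrow> bool"
  where "lin_braid r \<longleftrightarrow>
    (let r12 = assoc_right \<circ> tensor_map r id \<circ> assoc_left;
         r23 = tensor_map id r
     in r12 \<circ> r23 \<circ> r12 = r23 \<circ> r12 \<circ> r23)"

text \<open>
  The scalar \<open>\<lambda>\<close> with lower indices \<open>a|b|c|d\<close> and upper indices \<open>e|f|g|h\<close>. It is defined for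
  \<open>a \<le> b\<close>, \<open>c \<le> d\<close>, \<open>e \<le> f\<close>, \<open>g \<le> h\<close> only, and is set to \<open>0\<close> otherwise.
\<close>

definition coeff :: "(('x::locally_finite_order, 'k::field) DD \<Rightarrow> ('x, 'k) DD) \<Rightarrow>
    'x \<times> 'x \<times> 'x \<times> 'x \<Rightarrow> 'x \<times> 'x \<times> 'x \<times> 'x \<Rightarrow> 'k"
  where "coeff r = (\<lambda>(a, b, c, d) (e, f, g, h).
    if a \<le> b \<and> c \<le> d \<and> e \<le> f \<and> g \<le> h
    then Poly_Mapping.lookup (r (bas (Interval (a, b), Interval (c, d))))
           (Interval (e, f), Interval (g, h))
    else 0)"

end

theory Submission
  imports Defs "HOL-Library.Product_Order"
begin

text \<open>
  An automorphism \<open>r\<close> of the incidence coalgebra \<open>D \<otimes> D\<close> of the product poset \<open>X \<times> X\<close> permutes the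
  group-likes by an order automorphism \<open>(a, c) \<mapsto> (L a c, R a c)\<close>, and it sends \<open>[A, B]\<close> into the span
  of the images of the subintervals of \<open>[A, B]\<close>: otherwise \<open>[C, E] \<mapsto> m C E P P\<close> would be a nonzero
  idempotent of the incidence algebra of \<open>[A, B]\<close> with zero diagonal. Set-theoretic non-degeneracy
  forces \<open>L a = L b\<close> for \<open>a \<le> b\<close> and \<open>R _ c = R _ d\<close> for \<open>c \<le> d\<close>. Hence, in the coefficient of either
  triple composite at a basis vector, only the intermediate intervals listed in the stated sums
  contribute, and at a basis vector which is not of the form occurring in the statement both
  coefficients vanish.
\<close>

subsection \<open>Finitely supported functions\<close>

lemma lookup_bas: "Poly_Mapping.lookup (bas b :: _ \<Rightarrow>\<^sub>0 'k::field) c = (if b = c then 1 else 0)"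
  by (simp add: bas_def lookup_single when_def)

lemma keys_bas [simp]: "Poly_Mapping.keys (bas b :: _ \<Rightarrow>\<^sub>0 'k::field) = {b}"
  by (simp add: bas_def)

lemma bas_eq_iff: "bas x = (bas y :: _ \<Rightarrow>\<^sub>0 'k::field) \<longleftrightarrow> x = y"
proof
  assume "bas x = (bas y :: _ \<Rightarrow>\<^sub>0 'k)"
  then have "Poly_Mapping.keys (bas x :: _ \<Rightarrow>\<^sub>0 'k) = Poly_Mapping.keys (bas y :: _ \<Rightarrow>\<^sub>0 'k)"
    by (rule arg_cong)
  then show "x = y" by simp
qed simp

lemma sum_keys_delta:
  "(\<Sum>k\<in>Poly_Mapping.keys p. Poly_Mapping.lookup p k * (if k = b then 1 else 0)) =
    (Poly_Mapping.lookup p b :: 'k::field)"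
  by (simp add: in_keys_iff if_distrib cong: if_cong)

lemma lookup_lin_ext:
  "Poly_Mapping.lookup (lin_ext scl f p) y =
    (\<Sum>b\<in>Poly_Mapping.keys p. Poly_Mapping.lookup p b * Poly_Mapping.lookup (f b) y)"
  by (simp add: lin_ext_def lookup_sum)

lemma lin_ext_scl_bas [simp]: "lin_ext scl f (bas b) = f b"
  by (rule lin_ext_bas[OF vector_space_scl])

lemma linear_lin_ext_scl: "is_linear (lin_ext scl f)"
  by (rule linear_lin_ext[OF vector_space_scl])

lemma bas_expansion: "p = (\<Sum>b\<in>Poly_Mapping.keys p. scl (Poly_Mapping.lookup p b) (bas b))"
  by (rule poly_mapping_eqI)
    (auto simp: lookup_sum lookup_bas in_keys_iff if_distrib cong: if_cong)

lemma linear_sum_keys: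
  assumes "is_linear f"
  shows "f p = (\<Sum>b\<in>Poly_Mapping.keys p. scl (Poly_Mapping.lookup p b) (f (bas b)))"
proof -
  interpret Vector_Spaces.linear scl scl f by fact
  show ?thesis
    by (rule trans[OF arg_cong[OF bas_expansion, of f]]) (simp add: sum scale)
qed

lemma lookup_linear:
  assumes "is_linear f"
  shows "Poly_Mapping.lookup (f p) y =
    (\<Sum>b\<in>Poly_Mapping.keys p. Poly_Mapping.lookup p b * Poly_Mapping.lookup (f (bas b)) y)"
  by (rule trans[OF arg_cong[OF linear_sum_keys[OF assms, of p]]]) (simp add: lookup_sum)

lemma linear_ext_bas:
  assumes "is_linear f" "is_linear g" "\<And>b. f (bas b) = g (bas b)"
  shows "f = g"
proof
  fix p
  show "f p = g p"
    unfolding linear_sum_keys[OF assms(1), of p] linear_sum_keys[OF assms(2), of p] assms(3) ..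
qed

lemma linear_of_sum: "is_linear f \<Longrightarrow> f (\<Sum>i\<in>A. p i) = (\<Sum>i\<in>A. f (p i))"
  by (simp add: Vector_Spaces.linear_iff_module_hom module_hom.sum)

lemma linear_comp: "is_linear f \<Longrightarrow> is_linear g \<Longrightarrow> is_linear (g \<circ> f)"
  by (rule Vector_Spaces.linear_compose)

lemma linear_id_scl: "is_linear id"
  by (rule vector_space.linear_id[OF vector_space_scl])

section \<open>Tensor products in coordinates\<close>

lemma lookup_pure_tensor:
  "Poly_Mapping.lookup (pure_tensor p q) (b, c) = Poly_Mapping.lookup p b * Poly_Mapping.lookup q c"
proof -
  have inner: "Poly_Mapping.lookup (lin_ext scl (\<lambda>c. bas (b', c)) q) (b, c) =
      (if b' = b then Poly_Mapping.lookup q c else 0)" for b'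
    by (auto simp: lookup_lin_ext lookup_bas in_keys_iff if_distrib cong: if_cong)
  show ?thesis
    unfolding pure_tensor_def lookup_lin_ext[of _ p] inner
    by (simp add: in_keys_iff if_distrib cong: if_cong)
qed

lemma pure_tensor_bas [simp]: "pure_tensor (bas b) (bas c) = bas (b, c)"
  by (rule poly_mapping_eqI) (auto simp: lookup_pure_tensor lookup_bas split_paired_all)

lemma pure_tensor_sum:
  "pure_tensor (\<Sum>i\<in>A. p i) (\<Sum>j\<in>B. q j) = (\<Sum>i\<in>A. \<Sum>j\<in>B. pure_tensor (p i) (q j))"
  by (rule poly_mapping_eqI)
    (auto simp: lookup_pure_tensor lookup_sum sum_product split_paired_all)

lemma tensor_map_bas: "tensor_map f g (bas (b, d)) = pure_tensor (f (bas b)) (g (bas d))"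
  by (simp add: tensor_map_def)

lemma linear_tensor_map: "is_linear (tensor_map f g)"
  unfolding tensor_map_def by (rule linear_lin_ext_scl)

lemma tensor_map_pure_tensor:
  assumes "is_linear f" "is_linear g"
  shows "tensor_map f g (pure_tensor p q) = pure_tensor (f p) (g q)"
proof (rule poly_mapping_eqI)
  fix y :: "'c \<times> 'e"
  obtain c e where y: "y = (c, e)" by fastforce
  have k: "Poly_Mapping.keys (pure_tensor p q) = Poly_Mapping.keys p \<times> Poly_Mapping.keys q"
    by (auto simp: in_keys_iff lookup_pure_tensor)
  show "Poly_Mapping.lookup (tensor_map f g (pure_tensor p q)) y =
      Poly_Mapping.lookup (pure_tensor (f p) (g q)) y"
    unfolding y
    by (subst lookup_linear[OF linear_tensor_map], unfold k, simp add: lookup_pure_tensor lookup_linear[OF assms(1), of p]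
        lookup_linear[OF assms(2), of q] sum_product sum.cartesian_product,
      auto intro!: sum.cong simp: tensor_map_bas lookup_pure_tensor)
qed

lemma tensor_map_comp:
  assumes "is_linear f'" "is_linear g'"
  shows "tensor_map f' g' \<circ> tensor_map f g = tensor_map (f' \<circ> f) (g' \<circ> g)"
proof (rule linear_ext_bas)
  show "is_linear (tensor_map f' g' \<circ> tensor_map f g)"
    by (intro linear_comp linear_tensor_map)
  show "(tensor_map f' g' \<circ> tensor_map f g) (bas b) = tensor_map (f' \<circ> f) (g' \<circ> g) (bas b)" for b
    by (cases b) (simp add: tensor_map_bas tensor_map_pure_tensor assms)
qed (rule linear_tensor_map)

lemma tensor_map_id: "tensor_map id id = id"
proof (rule linear_ext_bas)
  show "tensor_map id id (bas b) = id (bas b)" for b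
    by (cases b) (simp add: tensor_map_bas)
qed (rule linear_tensor_map linear_id_scl)+

section \<open>Endpoints of intervals\<close>

lemma lower_Interval [simp]: "a \<le> b \<Longrightarrow> lower (Interval (a, b)) = a"
  by (simp add: lower.rep_eq Interval_inverse)

lemma upper_Interval [simp]: "a \<le> b \<Longrightarrow> upper (Interval (a, b)) = b"
  by (simp add: upper.rep_eq Interval_inverse)

lemma Interval_lower_upper [simp]: "Interval (lower I, upper I) = I"
  by (simp add: interval_eq_iff)

subsection \<open>Automorphisms of incidence coalgebras\<close>

text \<open>A nonzero summand \<open>f A C * f C B\<close> of \<open>f A B\<close> either has
  \<open>C = B\<close>, exhibiting \<open>f B B\<close>, or leads to the strictly smaller interval
  \<open>[A, C]\<close>.\<close>

lemma convolution_idempotent_diagonal: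
  fixes f :: "'z::locally_finite_order \<Rightarrow> 'z \<Rightarrow> 'k::field"
  assumes idem: "\<And>A B. A \<le> B \<Longrightarrow> (\<Sum>C\<in>{A..B}. f A C * f C B) = f A B"
  shows "A \<le> B \<Longrightarrow> f A B \<noteq> 0 \<Longrightarrow> \<exists>D\<in>{A..B}. f D D \<noteq> 0"
proof (induction "card {A..B}" arbitrary: A B rule: less_induct)
  case less
  have sub: "card {A'..B'} < card {A..B}" if "A \<le> A'" "B' \<le> B" "A \<noteq> A' \<or> B \<noteq> B'" "A' \<le> B'" for A' B'
  proof (rule psubset_card_mono[OF finite_closed_interval])
    show "{A'..B'} \<subset> {A..B}"
      using that less.prems(1) by (auto simp: psubset_eq)
  qed
  obtain C where C: "C \<in> {A..B}" "f A C * f C B \<noteq> 0"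
    using less.prems(2) unfolding idem[OF less.prems(1), symmetric]
    by (rule sum.not_neutral_contains_not_neutral)
  show ?case
  proof (cases "C = B")
    case True
    show ?thesis
      using C(2) less.prems(1) unfolding True by (intro bexI[of _ B]) auto
  next
    case False
    then have "\<exists>D\<in>{A..C}. f D D \<noteq> 0"
      using C by (intro less.hyps sub) auto
    then show ?thesis using C(1) by (meson atLeastAtMost_iff order_trans)
  qed
qed

text \<open>
  \<open>m A B P Q\<close> stands for the coefficient of the image of the interval \<open>[A, B]\<close> at \<open>[P, Q]\<close>
  under an endomorphism of the incidence coalgebra of \<open>'z\<close>; it is junk unless \<open>A \<le> B\<close>, \<open>P \<le> Q\<close>.
\<close>

locale incidence_matrix =
  fixes m :: "'z::locally_finite_order \<Rightarrow> 'z \<Rightarrow> 'z \<Rightarrow> 'z \<Rightarrow> 'k::field"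
  assumes comult: "\<And>A B P Q P' Q'. A \<le> B \<Longrightarrow> P \<le> Q \<Longrightarrow> P' \<le> Q' \<Longrightarrow>
      (\<Sum>C\<in>{A..B}. m A C P Q * m C B P' Q') = (if Q = P' then m A B P Q' else 0)"
    and counital: "\<And>A. \<exists>P. m A A P P \<noteq> 0"
begin

definition grouplike_map :: "'z \<Rightarrow> 'z"
  where "grouplike_map A = (THE P. m A A P P \<noteq> 0)"

text \<open>On a one-point interval the sum in \<open>comult\<close> has a single term. So the
  entries at \<open>(P, P)\<close> are orthogonal idempotents of the field: at most one is nonzero,
  and it is \<open>1\<close>. An entry with \<open>P < Q\<close> has square zero. With
  \<open>counital\<close> this makes the description in \<open>grouplike_map\<close> proper.\<close>

lemma diagonal:
  assumes "P \<le> Q"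
  shows "m A A P Q = (if P = grouplike_map A \<and> Q = grouplike_map A then 1 else 0)"
proof -
  have sq: "m A A P Q * m A A P' Q' = (if Q = P' then m A A P Q' else 0)"
    if "P \<le> Q" "P' \<le> Q'" for P Q P' Q'
    using comult[of A A P Q P' Q'] that by simp
  have uniq: "P = P'" if "m A A P P \<noteq> 0" "m A A P' P' \<noteq> 0" for P P'
    using sq[of P P P' P'] that by (auto split: if_splits)
  have "\<exists>!P. m A A P P \<noteq> 0"
    using counital uniq by blast
  then have g: "m A A P P \<noteq> 0 \<longleftrightarrow> P = grouplike_map A" for P
    using theI'[of "\<lambda>P. m A A P P \<noteq> 0"] uniq unfolding grouplike_map_def by blast
  have one: "m A A P P = 1" if "P = grouplike_map A" for P
    using sq[of P P P P] g[of P] that by simp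
  show ?thesis
  proof (cases "P = Q")
    case True
    then show ?thesis using g[of P] one[of P] by auto
  next
    case False
    then show ?thesis using sq[of P Q P Q] assms by auto
  qed
qed

lemma diagonal_eq_0_iff: "P \<le> Q \<Longrightarrow> m A A P Q \<noteq> 0 \<longleftrightarrow> P = grouplike_map A \<and> Q = grouplike_map A"
  by (simp add: diagonal)

text \<open>By \<open>comult\<close> with all four upper points equal to \<open>P\<close>, the
  function \<open>m _ _ P P\<close> is idempotent under convolution.\<close>

lemma counit_support:
  assumes "A \<le> B" "m A B P P \<noteq> 0"
  shows "\<exists>D\<in>{A..B}. P = grouplike_map D"
proof -
  have "\<exists>D\<in>{A..B}. m D D P P \<noteq> 0"
    by (rule convolution_idempotent_diagonal[of "\<lambda>A B. m A B P P"]) (use assms comult in auto)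
  then show ?thesis by (simp add: diagonal_eq_0_iff)
qed

text \<open>Splitting off \<open>[P, P]\<close> on the left and then \<open>[Q, Q]\<close> on the
  right gives \<open>A \<le> C \<le> E \<le> B\<close> with \<open>m A C P P\<close> and
  \<open>m E B Q Q\<close> nonzero. The preimages \<open>D\<close> and \<open>F\<close> are found in
  \<open>[A, C]\<close> and \<open>[E, B]\<close>, which is why they come out ordered.\<close>

lemma support:
  assumes "A \<le> B" "P \<le> Q" "m A B P Q \<noteq> 0"
  shows "\<exists>D F. A \<le> D \<and> D \<le> F \<and> F \<le> B \<and> P = grouplike_map D \<and> Q = grouplike_map F"
proof -
  have "(\<Sum>C\<in>{A..B}. m A C P P * m C B P Q) \<noteq> 0"
    using comult[of A B P P P Q] assms by simp
  then obtain C where C: "C \<in> {A..B}" "m A C P P \<noteq> 0" "m C B P Q \<noteq> 0"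
    by (auto elim: sum.not_neutral_contains_not_neutral)
  have "(\<Sum>E\<in>{C..B}. m C E P Q * m E B Q Q) \<noteq> 0"
    using comult[of C B P Q Q Q] assms C by simp
  then obtain E where E: "E \<in> {C..B}" "m E B Q Q \<noteq> 0"
    by (auto elim: sum.not_neutral_contains_not_neutral)
  obtain D where "D \<in> {A..C}" "P = grouplike_map D"
    using counit_support[of A C P] C by auto
  moreover obtain F where "F \<in> {E..B}" "Q = grouplike_map F"
    using counit_support[of E B Q] E by auto
  ultimately show ?thesis
    using C(1) E(1) by (metis atLeastAtMost_iff order_trans)
qed

end

text \<open>In the application \<open>n\<close> belongs to the inverse automorphism. A diagonal
  entry of either product of the two matrices is \<open>1\<close>, so it has a nonzero summand;
  recording just this avoids sums over all intervals of \<open>'z\<close>.\<close>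

locale incidence_matrix_pair = M: incidence_matrix m + N: incidence_matrix n
  for m n :: "'z::locally_finite_order \<Rightarrow> 'z \<Rightarrow> 'z \<Rightarrow> 'z \<Rightarrow> 'k::field" +
  assumes n_after_m: "\<And>A B. A \<le> B \<Longrightarrow> \<exists>P Q. P \<le> Q \<and> m A B P Q \<noteq> 0 \<and> n P Q A B \<noteq> 0"
    and m_after_n: "\<And>A B. A \<le> B \<Longrightarrow> \<exists>P Q. P \<le> Q \<and> n A B P Q \<noteq> 0 \<and> m P Q A B \<noteq> 0"
begin

lemma swapped: "incidence_matrix_pair n m"
  by unfold_locales (fact m_after_n n_after_m)+

lemma grouplike_map_inverse: "N.grouplike_map (M.grouplike_map A) = A"
  using n_after_m[of A A] by (auto simp: M.diagonal_eq_0_iff N.diagonal_eq_0_iff)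

text \<open>The interval \<open>[A, B]\<close> occurs in the image under \<open>n\<close> of some
  \<open>[P, Q]\<close>. By \<open>N.support\<close> its ends are images of some
  \<open>D \<le> F\<close> under the group-like map of \<open>n\<close>, which the one of
  \<open>m\<close> inverts.\<close>

lemma grouplike_map_mono:
  assumes "A \<le> B"
  shows "M.grouplike_map A \<le> M.grouplike_map B"
proof -
  interpret S: incidence_matrix_pair n m by (rule swapped)
  obtain P Q where PQ: "P \<le> Q" "n P Q A B \<noteq> 0"
    using n_after_m[OF assms] by blast
  then obtain D F where "P \<le> D" "D \<le> F" "F \<le> Q" "A = N.grouplike_map D" "B = N.grouplike_map F"
    using N.support[of P Q A B] assms by blast
  then show ?thesis by (simp add: S.grouplike_map_inverse)
qed

lemma grouplike_map_le_iff:
  "M.grouplike_map A \<le> M.grouplike_map B \<longleftrightarrow> A \<le> B"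
proof -
  interpret S: incidence_matrix_pair n m by (rule swapped)
  show ?thesis
    using grouplike_map_mono[of A B] S.grouplike_map_mono[of "M.grouplike_map A" "M.grouplike_map B"]
    by (auto simp: grouplike_map_inverse)
qed

lemma bij_grouplike_map: "bij M.grouplike_map"
proof -
  interpret S: incidence_matrix_pair n m by (rule swapped)
  show ?thesis
    by (rule o_bij[of N.grouplike_map]) (auto simp: grouplike_map_inverse S.grouplike_map_inverse)
qed

end

subsection \<open>The coalgebra of pairs of intervals\<close>

text \<open>With the componentwise order, the basis element \<open>[a, b] \<otimes> [c, d]\<close>
  corresponds to the interval from \<open>(a, c)\<close> to \<open>(b, d)\<close>, so
  \<open>D \<otimes> D\<close> becomes an incidence coalgebra.\<close>

instance prod :: (locally_finite_order, locally_finite_order) locally_finite_order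
  by standard (simp add: atLeastAtMost_prod_eq finite_closed_interval)

lemma lookup_swap_middle:
  fixes p :: "_ \<Rightarrow>\<^sub>0 'k::field"
  shows "Poly_Mapping.lookup (swap_middle p) ((b, d), (c, e)) = Poly_Mapping.lookup p ((b, c), (d, e))"
proof -
  have "Poly_Mapping.lookup
      ((\<lambda>((b, c), (d, e)). bas ((b, d), (c, e))) k :: _ \<Rightarrow>\<^sub>0 'k) ((b, d), (c, e)) =
      (if k = ((b, c), (d, e)) then 1 else 0)" for k
    by (auto simp: lookup_bas split: prod.split)
  note basis = this
  show ?thesis
    unfolding swap_middle_def lookup_lin_ext basis by (rule sum_keys_delta)
qed

lemma swap_middle_bas: "swap_middle (bas ((b, c), (d, e))) = bas ((b, d), (c, e))"
  by (simp add: swap_middle_def)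

lemma linear_swap_middle: "is_linear swap_middle"
  unfolding swap_middle_def by (rule linear_lin_ext_scl)

lemma comul_bas:
  "comul (bas I) = (\<Sum>c\<in>{lower I..upper I}. bas (Interval (lower I, c), Interval (c, upper I)))"
  by (simp add: comul_def)

lemma lookup_comul_bas:
  "Poly_Mapping.lookup (comul (bas I) :: _ \<Rightarrow>\<^sub>0 'k::field) (S, T) =
    (if upper S = lower T \<and> I = Interval (lower S, upper T) then 1 else 0)"
proof -
  have le: "lower S \<le> upper S" "lower T \<le> upper T" "lower I \<le> upper I" by simp_all
  have "Poly_Mapping.lookup (comul (bas I) :: _ \<Rightarrow>\<^sub>0 'k) (S, T) =
      (\<Sum>c\<in>{lower I..upper I}.
        if c = upper S \<and> upper S = lower T \<and> lower I = lower S \<and> upper I = upper T then 1 else 0)"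
    unfolding comul_bas lookup_sum
    by (intro sum.cong) (auto simp: lookup_bas interval_eq_iff)
  also have "\<dots> = (if upper S = lower T \<and> lower I = lower S \<and> upper I = upper T then 1 else 0)"
    using le by (cases "lower T = upper S") (auto simp: finite_closed_interval)
  \<comment> \<open>\<open>Interval (lower S, upper T)\<close> has the expected ends if
    \<open>lower S \<le> upper T\<close>, which follows from
    \<open>upper S = lower T\<close>.\<close>
  also have "(upper S = lower T \<and> lower I = lower S \<and> upper I = upper T) \<longleftrightarrow>
      (upper S = lower T \<and> I = Interval (lower S, upper T))"
    using le order_trans[of "lower S" "upper S" "upper T"] by (auto simp: interval_eq_iff)
  finally show ?thesis .
qed

lemma linear_comul2: "is_linear (comul2 :: ('x::locally_finite_order, 'k::field) DD \<Rightarrow> _)"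
  unfolding comul2_def by (intro linear_comp linear_tensor_map linear_swap_middle)

lemma comul2_bas:
  "comul2 (bas (I, J)) = (\<Sum>c\<in>{lower I..upper I}. \<Sum>d\<in>{lower J..upper J}.
    bas ((Interval (lower I, c), Interval (lower J, d)), (Interval (c, upper I), Interval (d, upper J))))"
  by (simp add: comul2_def tensor_map_bas comul_bas pure_tensor_sum
      linear_of_sum[OF linear_swap_middle] swap_middle_bas)

text \<open>Only the basis pair obtained by gluing \<open>S\<close> to \<open>T\<close> and
  \<open>S'\<close> to \<open>T'\<close> has this term in its coproduct. In this form compatibility
  with the coproduct turns into \<open>comult\<close>.\<close>

lemma lookup_comul2:
  fixes p :: "('x::locally_finite_order, 'k::field) DD"
  shows "Poly_Mapping.lookup (comul2 p) ((S, S'), (T, T')) =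
    (if upper S = lower T \<and> upper S' = lower T'
     then Poly_Mapping.lookup p (Interval (lower S, upper T), Interval (lower S', upper T'))
     else 0)"
proof -
  have "Poly_Mapping.lookup (comul2 (bas k :: ('x, 'k) DD)) ((S, S'), (T, T')) =
      (if k = (Interval (lower S, upper T), Interval (lower S', upper T')) then 1 else 0) *
      (if upper S = lower T \<and> upper S' = lower T' then 1 else 0)" for k
    by (cases k)
      (simp add: comul2_def tensor_map_bas lookup_swap_middle lookup_pure_tensor lookup_comul_bas)
  note basis = this
  show ?thesis
    unfolding lookup_linear[OF linear_comul2, of p] basis mult.assoc[symmetric]
      sum_distrib_right[symmetric] sum_keys_delta by simp
qed

lemma counit2_bas:
  "counit2 (bas (I, J)) = (if lower I = upper I \<and> lower J = upper J then 1 else 0)"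
  by (simp add: counit2_def form_tensor_form_def counit_def lin_ext_def lookup_bas)

text \<open>Source of \<open>counital\<close>: a group-like element has counit \<open>1\<close>, and
  so has its image.\<close>

lemma counit2_nonzeroD:
  assumes "counit2 p \<noteq> 0"
  shows "\<exists>a c. Poly_Mapping.lookup p (Interval (a, a), Interval (c, c)) \<noteq> 0"
proof -
  have "counit2 p = (\<Sum>(I, J)\<in>Poly_Mapping.keys p. Poly_Mapping.lookup p (I, J) *
      (if lower I = upper I \<and> lower J = upper J then 1 else 0))"
    by (auto simp: counit2_def form_tensor_form_def counit_def lin_ext_def lookup_bas intro!: sum.cong)
  then obtain I J where "Poly_Mapping.lookup p (I, J) \<noteq> 0" "upper I = lower I" "upper J = lower J"
    using assms by (auto elim!: sum.not_neutral_contains_not_neutral split: if_splits)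
  then have "Poly_Mapping.lookup p (Interval (lower I, lower I), Interval (lower J, lower J)) \<noteq> 0"
    using Interval_lower_upper[of I] Interval_lower_upper[of J] by simp
  then show ?thesis by blast
qed

section \<open>Inverse automorphisms and coefficient matrices\<close>

lemma linear_inv:
  assumes "is_linear f" "bij f"
  shows "is_linear (inv f)"
proof -
  interpret Vector_Spaces.linear scl scl f by fact
  note fI = surj_f_inv_f[OF bij_is_surj[OF assms(2)]]
  have "inv f (p + q) = inv f p + inv f q" for p q
    by (rule inv_f_eq[OF bij_is_inj[OF assms(2)]]) (simp add: add fI)
  moreover have "inv f (scl c p) = scl c (inv f p)" for c p
    by (rule inv_f_eq[OF bij_is_inj[OF assms(2)]]) (simp add: scale fI)
  ultimately show ?thesis
    by (simp add: Vector_Spaces.linear_iff vector_space_scl)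
qed

lemma coalgebra_automorphism_inv:
  assumes "coalgebra_automorphism r"
  shows "coalgebra_automorphism (inv r)"
proof -
  have r: "is_linear r" "bij r" "tensor_map r r \<circ> comul2 = comul2 \<circ> r" "counit2 \<circ> r = counit2"
    using assms by (auto simp: coalgebra_automorphism_def)
  have inv: "inv r \<circ> r = id" "r \<circ> inv r = id"
    using r(2) by (auto simp: bij_def surj_iff)
  have lin: "is_linear (inv r)"
    using r by (intro linear_inv)
  have r_inv: "r (inv r p) = p" for p
    using fun_cong[OF inv(2)] by simp
  have "tensor_map (inv r) (inv r) (comul2 p) = comul2 (inv r p)" for p
  proof -
    have "comul2 p = tensor_map r r (comul2 (inv r p))"
      using fun_cong[OF r(3), of "inv r p"] by (simp add: r_inv)
    moreover have "tensor_map (inv r) (inv r) (tensor_map r r q) = q" for q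
      using fun_cong[OF tensor_map_comp[OF lin lin, of r r], of q] by (simp add: inv(1) tensor_map_id)
    ultimately show ?thesis by simp
  qed
  moreover have "counit2 (inv r p) = counit2 p" for p
    using fun_cong[OF r(4), of "inv r p"] by (simp add: r_inv)
  ultimately show ?thesis
    using lin r(2) by (simp add: coalgebra_automorphism_def bij_imp_bij_inv fun_eq_iff)
qed

text \<open>The scalars \<lambda> regrouped so that lower ends \<open>(a, c)\<close>,
  \<open>(e, g)\<close> and upper ends \<open>(b, d)\<close>, \<open>(f, h)\<close> are points of
  the product poset. In contrast to \<open>coeff\<close> there is no guard: values at unordered
  indices are junk.\<close>

definition coeff_matrix ::
  "(('x::locally_finite_order, 'k::field) DD \<Rightarrow> ('x, 'k) DD) \<Rightarrow> 'x \<times> 'x \<Rightarrow> 'x \<times> 'x \<Rightarrow> 'x \<times> 'x \<Rightarrow> 'x \<times> 'x \<Rightarrow> 'k"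
  where "coeff_matrix r = (\<lambda>(a, c) (b, d) (e, g) (f, h).
    Poly_Mapping.lookup (r (bas (Interval (a, b), Interval (c, d)))) (Interval (e, f), Interval (g, h)))"

text \<open>Compare coefficients in the coproduct compatibility of \<open>r\<close>: one side is
  evaluated by \<open>comul2_bas\<close>, the other by \<open>lookup_comul2\<close>.\<close>

lemma incidence_matrix_coeff_matrix:
  assumes "coalgebra_automorphism r"
  shows "incidence_matrix (coeff_matrix r)"
proof
  have r: "is_linear r" "tensor_map r r \<circ> comul2 = comul2 \<circ> r" "counit2 \<circ> r = counit2"
    using assms by (auto simp: coalgebra_automorphism_def)
  show "(\<Sum>C\<in>{A..B}. coeff_matrix r A C P Q * coeff_matrix r C B P' Q') =
      (if Q = P' then coeff_matrix r A B P Q' else 0)"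
    if le: "A \<le> B" "P \<le> Q" "P' \<le> Q'" for A B P Q P' Q'
  proof -
    obtain a c where A: "A = (a, c)" by fastforce
    obtain b d where B: "B = (b, d)" by fastforce
    obtain e g where P: "P = (e, g)" by fastforce
    obtain f h where Q: "Q = (f, h)" by fastforce
    obtain e' g' where P': "P' = (e', g')" by fastforce
    obtain f' h' where Q': "Q' = (f', h')" by fastforce
    note eqs = A B P Q P' Q'
    have "tensor_map r r (comul2 (bas (Interval (a, b), Interval (c, d)))) =
        comul2 (r (bas (Interval (a, b), Interval (c, d))))"
      using fun_cong[OF r(2)] by simp
    then have "Poly_Mapping.lookup
        (tensor_map r r (comul2 (bas (Interval (a, b), Interval (c, d)))))
        ((Interval (e, f), Interval (g, h)), (Interval (e', f'), Interval (g', h'))) =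
       (if f = e' \<and> h = g' then Poly_Mapping.lookup (r (bas (Interval (a, b), Interval (c, d))))
         (Interval (e, f'), Interval (g, h')) else 0)"
      using le by (auto simp: lookup_comul2 eqs)
    moreover have "Poly_Mapping.lookup
        (tensor_map r r (comul2 (bas (Interval (a, b), Interval (c, d)))))
        ((Interval (e, f), Interval (g, h)), (Interval (e', f'), Interval (g', h'))) =
        (\<Sum>C\<in>{a..b} \<times> {c..d}. coeff_matrix r (a, c) C (e, g) (f, h) * coeff_matrix r C (b, d) (e', g') (f', h'))"
      using le
      by (simp add: eqs comul2_bas linear_of_sum[OF linear_tensor_map] tensor_map_bas lookup_sum
          lookup_pure_tensor coeff_matrix_def sum.cartesian_product')
    ultimately show ?thesis
      by (simp add: eqs coeff_matrix_def atLeastAtMost_prod_eq)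
  qed
  show "\<exists>P. coeff_matrix r A A P P \<noteq> 0" for A
  proof -
    obtain a c where A: "A = (a, c)" by fastforce
    have "counit2 (r (bas (Interval (a, a), Interval (c, c)))) \<noteq> 0"
      using fun_cong[OF r(3)] by (simp add: counit2_bas)
    from counit2_nonzeroD[OF this] show ?thesis
      by (auto simp: A coeff_matrix_def)
  qed
qed

text \<open>The coefficient of \<open>s' (s z)\<close> at \<open>z\<close> is \<open>1\<close> and
  is a finite sum over the support of \<open>s z\<close>, so some summand is nonzero.\<close>

lemma coeff_matrix_left_inverse:
  assumes "is_linear s'" "s' (s (bas (Interval (a, b), Interval (c, d)))) = bas (Interval (a, b), Interval (c, d))"
  shows "\<exists>P Q. P \<le> Q \<and> coeff_matrix s (a, c) (b, d) P Q \<noteq> 0 \<and> coeff_matrix s' P Q (a, c) (b, d) \<noteq> 0"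
proof -
  let ?z = "(Interval (a, b), Interval (c, d))"
  have "Poly_Mapping.lookup (s' (s (bas ?z))) ?z \<noteq> 0"
    unfolding assms(2) by (simp add: lookup_bas)
  then have "(\<Sum>k\<in>Poly_Mapping.keys (s (bas ?z)).
      Poly_Mapping.lookup (s (bas ?z)) k * Poly_Mapping.lookup (s' (bas k)) ?z) \<noteq> 0"
    by (subst (asm) lookup_linear[OF assms(1)])
  then obtain k where k:
    "Poly_Mapping.lookup (s (bas ?z)) k * Poly_Mapping.lookup (s' (bas k)) ?z \<noteq> 0"
    by (rule sum.not_neutral_contains_not_neutral)
  obtain I J where IJ: "k = (I, J)" by fastforce
  show ?thesis
    using k
    by (intro exI[of _ "(lower I, lower J)"] exI[of _ "(upper I, upper J)"])
      (auto simp: coeff_matrix_def IJ)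
qed

lemma incidence_matrix_pair_coeff_matrix:
  assumes "coalgebra_automorphism r"
  shows "incidence_matrix_pair (coeff_matrix r) (coeff_matrix (inv r))"
proof -
  have r: "is_linear r" "is_linear (inv r)" "bij r"
    using assms coalgebra_automorphism_inv by (auto simp: coalgebra_automorphism_def)
  interpret M: incidence_matrix "coeff_matrix r"
    using assms by (rule incidence_matrix_coeff_matrix)
  interpret N: incidence_matrix "coeff_matrix (inv r)"
    using assms by (intro incidence_matrix_coeff_matrix coalgebra_automorphism_inv)
  show ?thesis
  proof
    fix A B :: "'a \<times> 'a"
    obtain a c where A: "A = (a, c)" by fastforce
    obtain b d where B: "B = (b, d)" by fastforce
    show "\<exists>P Q. P \<le> Q \<and> coeff_matrix r A B P Q \<noteq> 0 \<and> coeff_matrix (inv r) P Q A B \<noteq> 0"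
      using r unfolding A B by (intro coeff_matrix_left_inverse) (auto simp: bij_def)
    show "\<exists>P Q. P \<le> Q \<and> coeff_matrix (inv r) A B P Q \<noteq> 0 \<and> coeff_matrix r P Q A B \<noteq> 0"
      using r unfolding A B by (intro coeff_matrix_left_inverse) (auto simp: bij_def surj_f_inv_f)
  qed
qed

text \<open>By \<open>diagonal\<close> the image of a group-like basis vector has a single nonzero
  coefficient, equal to \<open>1\<close>, so it is itself such a vector and determines the
  \<open>THE\<close> in \<open>induced_map\<close>.\<close>

lemma induced_map_eq_grouplike_map:
  assumes "coalgebra_automorphism r"
  shows "induced_map r = incidence_matrix.grouplike_map (coeff_matrix r)"
proof
  interpret M: incidence_matrix "coeff_matrix r"
    using assms by (rule incidence_matrix_coeff_matrix)
  fix A :: "'a \<times> 'a"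
  obtain a c where A: "A = (a, c)" by fastforce
  obtain p q where pq: "M.grouplike_map A = (p, q)" by fastforce
  have img: "r (bas (Interval (a, a), Interval (c, c))) = bas (Interval (p, p), Interval (q, q))"
  proof (rule poly_mapping_eqI)
    fix k :: "'a interval \<times> 'a interval"
    obtain I J where k: "k = (I, J)" by fastforce
    have "Poly_Mapping.lookup (r (bas (Interval (a, a), Interval (c, c)))) (I, J) =
        coeff_matrix r A A (lower I, lower J) (upper I, upper J)"
      by (simp add: coeff_matrix_def A)
    also have "\<dots> = (if I = Interval (p, p) \<and> J = Interval (q, q) then 1 else 0)"
      by (auto simp: M.diagonal pq interval_eq_iff)
    finally show "Poly_Mapping.lookup (r (bas (Interval (a, a), Interval (c, c)))) k =
        Poly_Mapping.lookup (bas (Interval (p, p), Interval (q, q))) k"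
      by (auto simp: k lookup_bas)
  qed
  show "induced_map r A = M.grouplike_map A"
    unfolding induced_map_def A prod.case img pq[unfolded A]
    by (rule the_equality) (auto simp: bas_eq_iff interval_eq_iff)
qed

subsection \<open>Non-degenerate braidings by order automorphisms\<close>

locale order_braiding =
  fixes s :: "'x::locally_finite_order \<times> 'x \<Rightarrow> 'x \<times> 'x"
  assumes le_iff: "s A \<le> s B \<longleftrightarrow> A \<le> B"
    and bij: "bij s"
    and nondegenerate: "set_nondegenerate s"
    and braid: "set_braid s"
begin

text \<open>In exponent notation \<open>L a c\<close> is ^a c and \<open>R a c\<close> is
  a^c.\<close>

abbreviation L :: "'x \<Rightarrow> 'x \<Rightarrow> 'x" where "L a c \<equiv> fst (s (a, c))"
abbreviation R :: "'x \<Rightarrow> 'x \<Rightarrow> 'x" where "R a c \<equiv> snd (s (a, c))"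

lemma L_eq_iff [simp]: "L a c = L a d \<longleftrightarrow> c = d"
  using nondegenerate injD[of "\<lambda>c. L a c" c d] by (auto simp: set_nondegenerate_def bij_is_inj)

lemma R_eq_iff [simp]: "R a c = R b c \<longleftrightarrow> a = b"
  using nondegenerate injD[of "\<lambda>a. R a c" a b] by (auto simp: set_nondegenerate_def bij_is_inj)

lemma pair_le_iff: "L a c \<le> L b d \<and> R a c \<le> R b d \<longleftrightarrow> a \<le> b \<and> c \<le> d"
  using le_iff[of "(a, c)" "(b, d)"] by (simp add: less_eq_prod_def)

lemma pair_surj: "\<exists>a c. p = L a c \<and> q = R a c"
proof -
  obtain z where z: "s z = (p, q)"
    using surjD[OF bij_is_surj[OF bij], of "(p, q)"] by metis
  show ?thesis
    by (rule exI[of _ "fst z"], rule exI[of _ "snd z"]) (simp add: z)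
qed

text \<open>
  The point \<open>(L b c, R a c)\<close> lies between the images of \<open>(a, c)\<close> and \<open>(b, c)\<close>, hence is the image
  of some \<open>(t, c)\<close>, and \<open>R t c = R a c\<close> forces \<open>t = a\<close>.
\<close>

lemma L_const: "a \<le> b \<Longrightarrow> L b c = L a c"
proof -
  assume "a \<le> b"
  obtain t t' where ts: "L b c = L t t'" "R a c = R t t'"
    using pair_surj by blast
  from \<open>a \<le> b\<close> have "L a c \<le> L t t'" "R t t' \<le> R b c"
    using pair_le_iff[of a c b c] by (simp_all flip: ts)
  then have "t' = c"
    using pair_le_iff[of a c t t'] pair_le_iff[of t t' b c] by (auto simp: ts)
  with ts show ?thesis by simp
qed

text \<open>Mirror image of \<open>L_const\<close>: \<open>(L a c, R a d)\<close> lies between the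
  images of \<open>(a, c)\<close> and \<open>(a, d)\<close>, hence is the image of some
  \<open>(a, t')\<close>, and \<open>L a c = L a t'\<close> forces \<open>t' = c\<close>.\<close>

lemma R_const: "c \<le> d \<Longrightarrow> R a d = R a c"
proof -
  assume "c \<le> d"
  obtain t t' where ts: "L a c = L t t'" "R a d = R t t'"
    using pair_surj by blast
  from \<open>c \<le> d\<close> have "R a c \<le> R t t'" "L t t' \<le> L a d"
    using pair_le_iff[of a c a d] by (simp_all flip: ts)
  then have "t = a"
    using pair_le_iff[of a c t t'] pair_le_iff[of t t' a d] by (auto simp: ts)
  with ts show ?thesis by simp
qed

lemma L_mono: "c \<le> d \<Longrightarrow> L a c \<le> L a d"
  using pair_le_iff[of a c a d] by simp

lemma R_mono: "a \<le> b \<Longrightarrow> R a c \<le> R b c"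
  using pair_le_iff[of a c b c] by simp

text \<open>Since \<open>R a\<close> is constant on \<open>[w, z]\<close>, the point
  \<open>(p', R a w)\<close> lies between the images of \<open>(a, w)\<close> and
  \<open>(a, z)\<close>, so its preimage has first component \<open>a\<close>. This pulls
  intermediate intervals back along \<open>L a\<close>.\<close>

lemma L_interval:
  assumes "w \<le> z" "L a w \<le> p" "p \<le> q" "q \<le> L a z"
  obtains i j where "w \<le> i" "i \<le> j" "j \<le> z" "p = L a i" "q = L a j"
proof -
  have ex: "\<exists>i. w \<le> i \<and> i \<le> z \<and> p' = L a i" if "L a w \<le> p'" "p' \<le> L a z" for p'
  proof -
    obtain t i where ti: "p' = L t i" "R a w = R t i"
      using pair_surj by blast
    have "a \<le> t \<and> w \<le> i"
      by (rule iffD1[OF pair_le_iff]) (use ti that in simp)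
    moreover have "t \<le> a \<and> i \<le> z"
      by (rule iffD1[OF pair_le_iff]) (use ti that R_const[OF assms(1), of a] in simp)
    ultimately show ?thesis using ti(1) order.antisym[of t a] by (intro exI[of _ i]) simp
  qed
  obtain i where i: "w \<le> i" "i \<le> z" "p = L a i"
    using ex[of p] assms by (auto intro: order_trans)
  obtain j where j: "w \<le> j" "j \<le> z" "q = L a j"
    using ex[of q] assms by (auto intro: order_trans)
  have "i \<le> j"
    using pair_le_iff[of a i a j] R_const[OF i(1), of a] R_const[OF j(1), of a] assms(3) i j by simp
  then show ?thesis using that i j by blast
qed

text \<open>The same argument with the components exchanged, as \<open>L _ c\<close> is constant on
  \<open>[x, y]\<close>.\<close>

lemma R_interval:
  assumes "x \<le> y" "R x c \<le> p" "p \<le> q" "q \<le> R y c"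
  obtains g h where "x \<le> g" "g \<le> h" "h \<le> y" "p = R g c" "q = R h c"
proof -
  have ex: "\<exists>g. x \<le> g \<and> g \<le> y \<and> p' = R g c" if "R x c \<le> p'" "p' \<le> R y c" for p'
  proof -
    obtain g t where gt: "L x c = L g t" "p' = R g t"
      using pair_surj by blast
    have "x \<le> g \<and> c \<le> t"
      by (rule iffD1[OF pair_le_iff]) (use gt that in simp)
    moreover have "g \<le> y \<and> t \<le> c"
      by (rule iffD1[OF pair_le_iff]) (use gt that L_const[OF assms(1), of c] in simp)
    ultimately show ?thesis using gt(2) order.antisym[of t c] by (intro exI[of _ g]) simp
  qed
  obtain g where g: "x \<le> g" "g \<le> y" "p = R g c"
    using ex[of p] assms by (auto intro: order_trans)
  obtain h where h: "x \<le> h" "h \<le> y" "q = R h c"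
    using ex[of q] assms by (auto intro: order_trans)
  have "g \<le> h"
    using pair_le_iff[of g c h c] L_const[OF g(1), of c] L_const[OF h(1), of c] assms(3) g h by simp
  then show ?thesis using that g h by blast
qed

section \<open>Braid relations and supports of the triple composites\<close>

lemma braid_L: "L (L a c) (L (R a c) e) = L a (L c e)"
  and braid_mid: "R (L a c) (L (R a c) e) = L (R a (L c e)) (R c e)"
  and braid_R: "R (R a c) e = R (R a (L c e)) (R c e)"
  using braid by (auto simp: set_braid_def fun_eq_iff prod_eq_iff case_prod_beta)

text \<open>\<open>M I J P Q\<close> stands for the coefficient of \<open>r (I \<otimes> J)\<close>
  at \<open>P \<otimes> Q\<close>. By \<open>L_const\<close> and \<open>R_const\<close> the base
  points can be fixed as \<open>lower I\<close> and \<open>lower J\<close>, whatever the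
  subintervals are.\<close>

definition supported :: "('x interval \<Rightarrow> 'x interval \<Rightarrow> 'x interval \<Rightarrow> 'x interval \<Rightarrow> 'k::zero) \<Rightarrow> bool"
  where "supported M \<longleftrightarrow> (\<forall>I J P Q. M I J P Q \<noteq> 0 \<longrightarrow>
    (\<exists>x y w z. lower I \<le> x \<and> x \<le> y \<and> y \<le> upper I \<and> lower J \<le> w \<and> w \<le> z \<and> z \<le> upper J \<and>
      lower P = L (lower I) w \<and> upper P = L (lower I) z \<and>
      lower Q = R x (lower J) \<and> upper Q = R y (lower J)))"

lemma supportedE:
  assumes "supported M" "M I J P Q \<noteq> 0"
  obtains x y w z where "lower I \<le> x" "x \<le> y" "y \<le> upper I" "lower J \<le> w" "w \<le> z" "z \<le> upper J"
    "lower P = L (lower I) w" "upper P = L (lower I) z" "lower Q = R x (lower J)" "upper Q = R y (lower J)"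
  using assms(1)[unfolded supported_def, rule_format, OF assms(2)] by (elim exE conjE) (rule that)

text \<open>The three nonzero coefficients form one path through r_12, r_23, r_12, which is traced
  back to nested subintervals of \<open>I\<close>, \<open>J\<close>, \<open>K\<close>.\<close>

lemma left_support:
  assumes M: "supported M"
    and nz: "M I J P Q \<noteq> 0" "M Q K S K' \<noteq> 0" "M P S I' J' \<noteq> 0"
    and abc: "lower I = a" "lower J = c" "lower K = e"
  obtains x y w z u v g h i j k l where
    "a \<le> x" "x \<le> g" "g \<le> h" "h \<le> y" "y \<le> upper I"
    "c \<le> w" "w \<le> i" "i \<le> j" "j \<le> z" "z \<le> upper J"
    "e \<le> u" "u \<le> k" "k \<le> l" "l \<le> v" "v \<le> upper K"
    "P = Interval (L a w, L a z)" "Q = Interval (R x c, R y c)"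
    "S = Interval (L (R x c) u, L (R x c) v)"
    "I' = Interval (L a (L c k), L a (L c l))"
    "J' = Interval (R (L a i) (L (R a i) e), R (L a j) (L (R a j) e))"
    "K' = Interval (R (R g c) e, R (R h c) e)"
proof -
  obtain x y w z where 1:
    "a \<le> x" "x \<le> y" "y \<le> upper I" "c \<le> w" "w \<le> z" "z \<le> upper J"
    "lower P = L a w" "upper P = L a z" "lower Q = R x c" "upper Q = R y c"
    by (rule supportedE[OF M nz(1), unfolded abc])
  obtain x' y' u v where 2:
    "R x c \<le> x'" "x' \<le> y'" "y' \<le> R y c" "e \<le> u" "u \<le> v" "v \<le> upper K"
    "lower S = L (R x c) u" "upper S = L (R x c) v" "lower K' = R x' e" "upper K' = R y' e"
    by (rule supportedE[OF M nz(2), unfolded abc 1(7-10)])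
  obtain i' j' k' l' where 3:
    "L a w \<le> i'" "i' \<le> j'" "j' \<le> L a z" "L (R x c) u \<le> k'" "k' \<le> l'" "l' \<le> L (R x c) v"
    "lower I' = L (L a w) k'" "upper I' = L (L a w) l'"
    "lower J' = R i' (L (R x c) u)" "upper J' = R j' (L (R x c) u)"
    by (rule supportedE[OF M nz(3), unfolded abc 1(7-10) 2(7-10)])
  \<comment> \<open>The ends produced by the second and third coefficient lie in images of intervals
    found before, so they pull back to points of \<open>I\<close>, \<open>J\<close> and
    \<open>K\<close>.\<close>
  obtain g h where gh: "x \<le> g" "g \<le> h" "h \<le> y" "x' = R g c" "y' = R h c"
    using R_interval[OF 1(2) 2(1-3)] by blast
  obtain i j where ij: "w \<le> i" "i \<le> j" "j \<le> z" "i' = L a i" "j' = L a j"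
    using L_interval[OF 1(5) 3(1-3)] by blast
  obtain k l where kl: "u \<le> k" "k \<le> l" "l \<le> v" "k' = L (R x c) k" "l' = L (R x c) l"
    using L_interval[OF 2(5) 3(4-6)] by blast
  \<comment> \<open>Base points are lowered: \<open>R x c\<close>, \<open>L a w\<close> and
    \<open>L (R a c) u\<close> lie above \<open>R a c\<close>, \<open>L a c\<close> and
    \<open>L (R a c) e\<close>, so \<open>L_const\<close> and \<open>R_const\<close> apply, and then
    \<open>braid_L\<close> does.\<close>
  have Lx: "L (R x c) t = L (R a c) t" for t
    using L_const R_mono 1(1) by blast
  have first: "L (L a w) (L (R x c) t) = L a (L c t)" for t
    using L_const[OF L_mono[OF 1(4), of a]] by (simp add: Lx braid_L)
  have second: "R (L a t) (L (R x c) u) = R (L a t) (L (R a t) e)" if "c \<le> t" for t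
    using R_const[OF L_mono[OF 2(4), of "R a c"]] R_const[OF that, of a] by (simp add: Lx)
  have "c \<le> i" "c \<le> j"
    using 1 ij by (auto intro: order_trans)
  then have eqs: "P = Interval (L a w, L a z)" "Q = Interval (R x c, R y c)"
    "S = Interval (L (R x c) u, L (R x c) v)"
    "I' = Interval (L a (L c k), L a (L c l))"
    "J' = Interval (R (L a i) (L (R a i) e), R (L a j) (L (R a j) e))"
    "K' = Interval (R (R g c) e, R (R h c) e)"
    using Interval_lower_upper[of P] Interval_lower_upper[of Q] Interval_lower_upper[of S]
      Interval_lower_upper[of I'] Interval_lower_upper[of J'] Interval_lower_upper[of K']
    by (simp_all add: 1 2 3 gh ij kl first second)
  show thesis
    by (rule that[OF 1(1) gh(1-3) 1(3,4) ij(1-3) 1(6) 2(4) kl(1-3) 2(6) eqs])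
qed

text \<open>The counterpart for r_23, r_12, r_23. The ends of \<open>I'\<close> and
  \<open>K'\<close> take the same form as in \<open>left_support\<close>, those of \<open>J'\<close>
  the form on the right of \<open>braid_mid\<close>.\<close>

lemma right_support:
  assumes M: "supported M"
    and nz: "M J K U V \<noteq> 0" "M I U I' W \<noteq> 0" "M W V J' K' \<noteq> 0"
    and abc: "lower I = a" "lower J = c" "lower K = e"
  obtains x y w z u v g h i j k l where
    "a \<le> x" "x \<le> g" "g \<le> h" "h \<le> y" "y \<le> upper I"
    "c \<le> w" "w \<le> i" "i \<le> j" "j \<le> z" "z \<le> upper J"
    "e \<le> u" "u \<le> k" "k \<le> l" "l \<le> v" "v \<le> upper K"
    "U = Interval (L c u, L c v)" "V = Interval (R w e, R z e)"
    "W = Interval (R x (L c u), R y (L c u))"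
    "I' = Interval (L a (L c k), L a (L c l))"
    "J' = Interval (L (R a (L i e)) (R i e), L (R a (L j e)) (R j e))"
    "K' = Interval (R (R g c) e, R (R h c) e)"
proof -
  obtain w z u v where 1:
    "c \<le> w" "w \<le> z" "z \<le> upper J" "e \<le> u" "u \<le> v" "v \<le> upper K"
    "lower U = L c u" "upper U = L c v" "lower V = R w e" "upper V = R z e"
    by (rule supportedE[OF M nz(1), unfolded abc])
  obtain x y k' l' where 2:
    "a \<le> x" "x \<le> y" "y \<le> upper I" "L c u \<le> k'" "k' \<le> l'" "l' \<le> L c v"
    "lower I' = L a k'" "upper I' = L a l'" "lower W = R x (L c u)" "upper W = R y (L c u)"
    by (rule supportedE[OF M nz(2), unfolded abc 1(7-10)])
  obtain g' h' i' j' where 3: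
    "R x (L c u) \<le> g'" "g' \<le> h'" "h' \<le> R y (L c u)" "R w e \<le> i'" "i' \<le> j'" "j' \<le> R z e"
    "lower J' = L (R x (L c u)) i'" "upper J' = L (R x (L c u)) j'"
    "lower K' = R g' (R w e)" "upper K' = R h' (R w e)"
    by (rule supportedE[OF M nz(3), unfolded abc 1(7-10) 2(7-10)])
  obtain g h where gh: "x \<le> g" "g \<le> h" "h \<le> y" "g' = R g (L c u)" "h' = R h (L c u)"
    using R_interval[OF 2(2) 3(1-3)] by blast
  obtain i j where ij: "w \<le> i" "i \<le> j" "j \<le> z" "i' = R i e" "j' = R j e"
    using R_interval[OF 1(2) 3(4-6)] by blast
  obtain k l where kl: "u \<le> k" "k \<le> l" "l \<le> v" "k' = L c k" "l' = L c l"
    using L_interval[OF 1(5) 2(4-6)] by blast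
  \<comment> \<open>Base points are lowered again, \<open>L c u\<close> to \<open>L c e\<close> and
    \<open>R w e\<close> to \<open>R c e\<close>; \<open>braid_R\<close> then brings
    \<open>K'\<close> into the common form.\<close>
  have Ru: "R t (L c u) = R t (L c e)" for t
    using R_const L_mono 1(4) by blast
  have second: "L (R x (L c u)) t' = L (R a (L t e)) t'" if "c \<le> t" for t t'
    using L_const[OF R_mono[OF 2(1), of "L c e"]] L_const[OF that, of e] by (simp add: Ru)
  have third: "R (R t (L c u)) (R w e) = R (R t c) e" for t
    using R_const[OF R_mono[OF 1(1), of e]] by (simp add: Ru flip: braid_R)
  have "c \<le> i" "c \<le> j"
    using 1 ij by (auto intro: order_trans)
  then have eqs: "U = Interval (L c u, L c v)" "V = Interval (R w e, R z e)"
    "W = Interval (R x (L c u), R y (L c u))"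
    "I' = Interval (L a (L c k), L a (L c l))"
    "J' = Interval (L (R a (L i e)) (R i e), L (R a (L j e)) (R j e))"
    "K' = Interval (R (R g c) e, R (R h c) e)"
    using Interval_lower_upper[of U] Interval_lower_upper[of V] Interval_lower_upper[of W]
      Interval_lower_upper[of I'] Interval_lower_upper[of J'] Interval_lower_upper[of K']
      second[of i] second[of j]
    by (simp_all add: 1 2 3 gh ij kl third)
  show thesis
    by (rule that[OF 2(1) gh(1-3) 2(3) 1(1) ij(1-3) 1(3,4) kl(1-3) 1(6) eqs])
qed

end

subsection \<open>Coefficients of the triple composites\<close>

text \<open>The operators \<open>r12\<close> and, below, \<open>r23\<close> of
  \<open>lin_braid\<close>; left and right name the pair of tensor factors acted on.\<close>

definition braid_left :: "(('b \<times> 'b \<Rightarrow>\<^sub>0 'k::field) \<Rightarrow> ('b \<times> 'b \<Rightarrow>\<^sub>0 'k)) \<Rightarrow>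
    ('b \<times> 'b \<times> 'b \<Rightarrow>\<^sub>0 'k) \<Rightarrow> ('b \<times> 'b \<times> 'b \<Rightarrow>\<^sub>0 'k)"
  where "braid_left r = assoc_right \<circ> tensor_map r id \<circ> assoc_left"

definition braid_right :: "(('b \<times> 'b \<Rightarrow>\<^sub>0 'k::field) \<Rightarrow> ('b \<times> 'b \<Rightarrow>\<^sub>0 'k)) \<Rightarrow>
    ('b \<times> 'b \<times> 'b \<Rightarrow>\<^sub>0 'k) \<Rightarrow> ('b \<times> 'b \<times> 'b \<Rightarrow>\<^sub>0 'k)"
  where "braid_right r = tensor_map id r"

lemma linear_assoc_right: "is_linear assoc_right"
  unfolding assoc_right_def by (rule linear_lin_ext_scl)

lemma linear_assoc_left: "is_linear assoc_left"
  unfolding assoc_left_def by (rule linear_lin_ext_scl)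

lemma linear_braid_left: "is_linear (braid_left r)"
  unfolding braid_left_def
  by (intro linear_comp linear_tensor_map linear_assoc_left linear_assoc_right)

lemma linear_braid_right: "is_linear (braid_right r)"
  unfolding braid_right_def by (rule linear_tensor_map)

lemma linear_scale: "is_linear f \<Longrightarrow> f (scl c p) = scl c (f p)"
  by (simp add: Vector_Spaces.linear_iff)

lemma pure_tensor_eq_sum:
  "pure_tensor p q = (\<Sum>i\<in>Poly_Mapping.keys p. \<Sum>j\<in>Poly_Mapping.keys q.
    scl (Poly_Mapping.lookup p i * Poly_Mapping.lookup q j) (bas (i, j)))"
proof (rule poly_mapping_eqI)
  fix k :: "'a \<times> 'b"
  obtain b c where k: "k = (b, c)" by fastforce
  have "Poly_Mapping.lookup (pure_tensor p q) (b, c) =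
      Poly_Mapping.lookup (pure_tensor (\<Sum>i\<in>Poly_Mapping.keys p. scl (Poly_Mapping.lookup p i) (bas i))
        (\<Sum>j\<in>Poly_Mapping.keys q. scl (Poly_Mapping.lookup q j) (bas j))) (b, c)"
    by (simp flip: bas_expansion)
  also have "\<dots> = Poly_Mapping.lookup (\<Sum>i\<in>Poly_Mapping.keys p. \<Sum>j\<in>Poly_Mapping.keys q.
      scl (Poly_Mapping.lookup p i * Poly_Mapping.lookup q j) (bas (i, j))) (b, c)"
    by (auto simp: pure_tensor_sum lookup_sum lookup_pure_tensor lookup_bas intro!: sum.cong)
  finally show "Poly_Mapping.lookup (pure_tensor p q) k = Poly_Mapping.lookup (\<Sum>i\<in>Poly_Mapping.keys p.
      \<Sum>j\<in>Poly_Mapping.keys q. scl (Poly_Mapping.lookup p i * Poly_Mapping.lookup q j) (bas (i, j))) k"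
    unfolding k .
qed

lemma braid_left_bas:
  "braid_left r (bas (I, z)) = (\<Sum>x\<in>Poly_Mapping.keys (r (bas (I, fst z))).
    scl (Poly_Mapping.lookup (r (bas (I, fst z))) x) (bas (fst x, snd x, snd z)))"
proof -
  obtain J K where z: "z = (J, K)" by fastforce
  have "braid_left r (bas (I, z)) = assoc_right (pure_tensor (r (bas (I, J))) (bas K))"
    by (simp add: braid_left_def assoc_left_def tensor_map_bas z)
  then show ?thesis
    by (simp add: pure_tensor_eq_sum linear_of_sum[OF linear_assoc_right]
        linear_scale[OF linear_assoc_right] lookup_bas z)
      (simp add: assoc_right_def case_prod_beta)
qed

lemma braid_right_bas:
  "braid_right r (bas (I, z)) = (\<Sum>x\<in>Poly_Mapping.keys (r (bas z)).
    scl (Poly_Mapping.lookup (r (bas z)) x) (bas (I, x)))"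
  by (simp add: braid_right_def tensor_map_bas pure_tensor_eq_sum lookup_bas)

lemma lookup_linear_braid_left:
  assumes "is_linear f"
  shows "Poly_Mapping.lookup (f (braid_left r (bas (I, z)))) y =
    (\<Sum>x\<in>Poly_Mapping.keys (r (bas (I, fst z))).
      Poly_Mapping.lookup (r (bas (I, fst z))) x * Poly_Mapping.lookup (f (bas (fst x, snd x, snd z))) y)"
  unfolding braid_left_bas by (simp add: linear_of_sum[OF assms] linear_scale[OF assms] lookup_sum)

lemma lookup_linear_braid_right:
  assumes "is_linear f"
  shows "Poly_Mapping.lookup (f (braid_right r (bas (I, z)))) y =
    (\<Sum>x\<in>Poly_Mapping.keys (r (bas z)).
      Poly_Mapping.lookup (r (bas z)) x * Poly_Mapping.lookup (f (bas (I, x))) y)"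
  unfolding braid_right_bas by (simp add: linear_of_sum[OF assms] linear_scale[OF assms] lookup_sum)

lemma lookup_braid_left:
  "Poly_Mapping.lookup (braid_left r (bas (I, z))) (P, Q, K') =
    (if snd z = K' then Poly_Mapping.lookup (r (bas (I, fst z))) (P, Q) else 0)"
proof -
  let ?p = "r (bas (I, fst z))"
  have "Poly_Mapping.lookup (braid_left r (bas (I, z))) (P, Q, K') =
      (\<Sum>k\<in>Poly_Mapping.keys ?p. Poly_Mapping.lookup ?p k * (if k = (P, Q) then 1 else 0) *
        (if snd z = K' then 1 else 0))"
    unfolding braid_left_bas lookup_sum by (rule sum.cong) (auto simp: lookup_bas)
  also have "\<dots> = (if snd z = K' then Poly_Mapping.lookup ?p (P, Q) else 0)"
    unfolding sum_distrib_right[symmetric] sum_keys_delta by simp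
  finally show ?thesis .
qed

lemma lookup_braid_right:
  "Poly_Mapping.lookup (braid_right r (bas (I, z))) (I', w) =
    (if I = I' then Poly_Mapping.lookup (r (bas z)) w else 0)"
  by (simp add: braid_right_def tensor_map_bas lookup_pure_tensor lookup_bas)

text \<open>The supports of the successive images are not explicit, so the sum over them is
  exchanged for one over any finite \<open>T\<close> containing all paths of nonzero weight. Later
  \<open>T\<close> comes from the index box of the statement, or is empty.\<close>

lemma lookup_left_composite:
  fixes r :: "('b \<times> 'b \<Rightarrow>\<^sub>0 'k::field) \<Rightarrow> ('b \<times> 'b \<Rightarrow>\<^sub>0 'k)"
  defines "M \<equiv> \<lambda>I J P Q. Poly_Mapping.lookup (r (bas (I, J))) (P, Q)"
  assumes "finite T"
    and T: "\<And>P Q S. M I J P Q \<noteq> 0 \<Longrightarrow> M Q K S K' \<noteq> 0 \<Longrightarrow> M P S I' J' \<noteq> 0 \<Longrightarrow> (P, Q, S) \<in> T"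
  shows "Poly_Mapping.lookup (braid_left r (braid_right r (braid_left r (bas (I, J, K))))) (I', J', K') =
    (\<Sum>(P, Q, S)\<in>T. M I J P Q * M Q K S K' * M P S I' J')"
proof -
  let ?X = "Poly_Mapping.keys (r (bas (I, J)))"
  let ?Z = "\<lambda>x. Poly_Mapping.keys (r (bas (snd x, K)))"
  \<comment> \<open>Here \<open>x = (P, Q)\<close> comes from the first application of
    \<open>r\<close> and \<open>z\<close> from the second. The last one leaves the third factor
    alone, so only \<open>z = (S, K')\<close> counts.\<close>
  let ?m = "\<lambda>(x, z). Poly_Mapping.lookup (r (bas (I, J))) x * (Poly_Mapping.lookup (r (bas (snd x, K))) z *
          (if snd z = K' then M (fst x) (fst z) I' J' else 0))"
  have lin: "is_linear (braid_left r \<circ> braid_right r)"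
    by (intro linear_comp linear_braid_left linear_braid_right)
  have "Poly_Mapping.lookup (braid_left r (braid_right r (braid_left r (bas (I, J, K))))) (I', J', K') =
      (\<Sum>x\<in>?X. \<Sum>z\<in>?Z x. ?m (x, z))"
    using lookup_linear_braid_left[OF lin, of r I "(J, K)" "(I', J', K')"]
    unfolding M_def by (simp add: lookup_linear_braid_right[OF linear_braid_left] lookup_braid_left sum_distrib_left)
  also have "\<dots> = (\<Sum>k\<in>Sigma ?X ?Z. ?m k)"
    by (subst sum.Sigma) auto
  also have "\<dots> = (\<Sum>k\<in>{k\<in>Sigma ?X ?Z. ?m k \<noteq> 0}. ?m k)"
    by (intro sum.mono_neutral_right) auto
  \<comment> \<open>The bijection forgets and reinserts the fixed \<open>K'\<close>;
    \<open>T'\<close> collects the members of \<open>T\<close> of weight zero.\<close>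
  also have "\<dots> = (\<Sum>(P, Q, S)\<in>T. M I J P Q * M Q K S K' * M P S I' J')"
    by (rule sum.reindex_bij_witness_not_neutral[where
          S' = "{}" and
          T' = "T \<inter> {(P, Q, S). M I J P Q * M Q K S K' * M P S I' J' = 0}" and
          i = "\<lambda>(P, Q, S). ((P, Q), (S, K'))" and j = "\<lambda>((P, Q), (S, _)). (P, Q, S)"])
      (use \<open>finite T\<close> T in \<open>auto simp: M_def in_keys_iff split: if_splits\<close>)
  finally show ?thesis .
qed

text \<open>Same exchange; now the last operator fixes the first factor, so the second key is
  \<open>(I', W)\<close>.\<close>

lemma lookup_right_composite:
  fixes r :: "('b \<times> 'b \<Rightarrow>\<^sub>0 'k::field) \<Rightarrow> ('b \<times> 'b \<Rightarrow>\<^sub>0 'k)"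
  defines "M \<equiv> \<lambda>I J P Q. Poly_Mapping.lookup (r (bas (I, J))) (P, Q)"
  assumes "finite T"
    and T: "\<And>U V W. M J K U V \<noteq> 0 \<Longrightarrow> M I U I' W \<noteq> 0 \<Longrightarrow> M W V J' K' \<noteq> 0 \<Longrightarrow> (U, V, W) \<in> T"
  shows "Poly_Mapping.lookup (braid_right r (braid_left r (braid_right r (bas (I, J, K))))) (I', J', K') =
    (\<Sum>(U, V, W)\<in>T. M J K U V * M I U I' W * M W V J' K')"
proof -
  let ?X = "Poly_Mapping.keys (r (bas (J, K)))"
  let ?Z = "\<lambda>x. Poly_Mapping.keys (r (bas (I, fst x)))"
  let ?m = "\<lambda>(x, z). Poly_Mapping.lookup (r (bas (J, K))) x * (Poly_Mapping.lookup (r (bas (I, fst x))) z *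
          (if fst z = I' then M (snd z) (snd x) J' K' else 0))"
  have lin: "is_linear (braid_right r \<circ> braid_left r)"
    by (intro linear_comp linear_braid_left linear_braid_right)
  have "Poly_Mapping.lookup (braid_right r (braid_left r (braid_right r (bas (I, J, K))))) (I', J', K') =
      (\<Sum>x\<in>?X. \<Sum>z\<in>?Z x. ?m (x, z))"
    using lookup_linear_braid_right[OF lin, of r I "(J, K)" "(I', J', K')"]
    unfolding M_def by (simp add: lookup_linear_braid_left[OF linear_braid_right] lookup_braid_right sum_distrib_left)
  also have "\<dots> = (\<Sum>k\<in>Sigma ?X ?Z. ?m k)"
    by (subst sum.Sigma) auto
  also have "\<dots> = (\<Sum>k\<in>{k\<in>Sigma ?X ?Z. ?m k \<noteq> 0}. ?m k)"
    by (intro sum.mono_neutral_right) auto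
  also have "\<dots> = (\<Sum>(U, V, W)\<in>T. M J K U V * M I U I' W * M W V J' K')"
    by (rule sum.reindex_bij_witness_not_neutral[where
          S' = "{}" and
          T' = "T \<inter> {(U, V, W). M J K U V * M I U I' W * M W V J' K' = 0}" and
          i = "\<lambda>(U, V, W). ((U, V), (I', W))" and j = "\<lambda>((U, V), (_, W)). (U, V, W)"])
      (use \<open>finite T\<close> T in \<open>auto simp: M_def in_keys_iff split: if_splits\<close>)
  finally show ?thesis .
qed

lemma lin_braid_iff:
  "lin_braid r \<longleftrightarrow> (\<forall>I J K I' J' K'.
    Poly_Mapping.lookup (braid_left r (braid_right r (braid_left r (bas (I, J, K))))) (I', J', K') =
    Poly_Mapping.lookup (braid_right r (braid_left r (braid_right r (bas (I, J, K))))) (I', J', K'))"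
  (is "_ \<longleftrightarrow> ?rhs")
proof -
  let ?l = "braid_left r \<circ> braid_right r \<circ> braid_left r"
  let ?r = "braid_right r \<circ> braid_left r \<circ> braid_right r"
  have "lin_braid r \<longleftrightarrow> ?l = ?r"
    by (simp only: lin_braid_def Let_def braid_left_def braid_right_def)
  also have "\<dots> \<longleftrightarrow> (\<forall>t. ?l (bas t) = ?r (bas t))"
  proof
    assume "?l = ?r"
    then show "\<forall>t. ?l (bas t) = ?r (bas t)" by (simp only: simp_thms)
  next
    assume "\<forall>t. ?l (bas t) = ?r (bas t)"
    then show "?l = ?r"
      by (intro linear_ext_bas linear_comp linear_braid_left linear_braid_right) blast
  qed
  also have "\<dots> \<longleftrightarrow> ?rhs"
    by (simp add: poly_mapping_eq_iff fun_eq_iff split_paired_All)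
  finally show ?thesis .
qed

lemma Interval_eq_iff:
  "a \<le> b \<Longrightarrow> c \<le> d \<Longrightarrow> Interval (a, b) = Interval (c, d) \<longleftrightarrow> a = c \<and> b = d"
  by (simp add: Interval_inject)

section \<open>Matching coefficients of the composites with the stated sums\<close>

context order_braiding
begin

text \<open>In the middle index of the statement \<open>i\<close> occurs twice. Lowering one
  occurrence to \<open>c\<close> makes the index visibly monotone and injective in
  \<open>i\<close>.\<close>

lemma mid_left: "c \<le> i \<Longrightarrow> R (L a i) (L (R a i) e) = R (L a i) (L (R a c) e)"
  using R_const[of c i a] by simp

lemma mid_right: "c \<le> i \<Longrightarrow> L (R a (L i e)) (R i e) = L (R a (L c e)) (R i e)"
  using L_const[of c i e] by simp

definition left_sum where
  "left_sum lam a b c d e f g h i j k l =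
    (\<Sum>x\<in>{a..g}. \<Sum>y\<in>{h..b}. \<Sum>w\<in>{c..i}. \<Sum>z\<in>{j..d}. \<Sum>u\<in>{e..k}. \<Sum>v\<in>{l..f}.
      lam (a, b, c, d) (L a w, L a z, R x c, R y c) *
      lam (R x c, R y c, e, f) (L (R x c) u, L (R x c) v, R (R g c) e, R (R h c) e) *
      lam (L a w, L a z, L (R x c) u, L (R x c) v)
        (L a (L c k), L a (L c l), R (L a i) (L (R a i) e), R (L a j) (L (R a j) e)))"

definition right_sum where
  "right_sum lam a b c d e f g h i j k l =
    (\<Sum>x\<in>{a..g}. \<Sum>y\<in>{h..b}. \<Sum>w\<in>{c..i}. \<Sum>z\<in>{j..d}. \<Sum>u\<in>{e..k}. \<Sum>v\<in>{l..f}.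
      lam (c, d, e, f) (L c u, L c v, R w e, R z e) *
      lam (a, b, L c u, L c v) (L a (L c k), L a (L c l), R x (L c u), R y (L c u)) *
      lam (R x (L c u), R y (L c u), R w e, R z e)
        (L (R a (L i e)) (R i e), L (R a (L j e)) (R j e), R (R g c) e, R (R h c) e))"

text \<open>The basis vector of \<open>D \<otimes> D \<otimes> D\<close> whose coefficients in the
  two composites are \<open>left_sum\<close> and \<open>right_sum\<close>.\<close>

definition target :: "'x \<Rightarrow> 'x \<Rightarrow> 'x \<Rightarrow> 'x \<Rightarrow> 'x \<Rightarrow> 'x \<Rightarrow> 'x \<Rightarrow> 'x \<Rightarrow> 'x \<Rightarrow>
    'x interval \<times> 'x interval \<times> 'x interval"
  where "target a c e g h i j k l =
    (Interval (L a (L c k), L a (L c l)),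
     Interval (R (L a i) (L (R a i) e), R (L a j) (L (R a j) e)),
     Interval (R (R g c) e, R (R h c) e))"

text \<open>After \<open>mid_left\<close> each end depends injectively on one of the six points.
  This identifies the points delivered by the support lemmas with the prescribed ones.\<close>

lemma target_eq_iff:
  assumes "c \<le> i" "c \<le> i'" "g \<le> h" "i \<le> j" "k \<le> l" "g' \<le> h'" "i' \<le> j'" "k' \<le> l'"
  shows "target a c e g h i j k l = target a c e g' h' i' j' k' l' \<longleftrightarrow>
    g = g' \<and> h = h' \<and> i = i' \<and> j = j' \<and> k = k' \<and> l = l'"
proof -
  have "c \<le> j" "c \<le> j'" using assms by auto
  note mid = mid_left[OF assms(1)] mid_left[OF assms(2)] mid_left[OF this(1)] mid_left[OF this(2)]
  \<comment> \<open>Equality of intervals reduces to their ends by \<open>Interval_eq_iff\<close>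
    when the ends are ordered.\<close>
  have mono: "L a (L c k) \<le> L a (L c l)" "L a (L c k') \<le> L a (L c l')"
    "R (L a i) t \<le> R (L a j) t" "R (L a i') t \<le> R (L a j') t"
    "R (R g c) e \<le> R (R h c) e" "R (R g' c) e \<le> R (R h' c) e" for t
    using assms by (simp_all add: L_mono R_mono)
  show ?thesis
    unfolding target_def mid by (auto simp: Interval_eq_iff mono)
qed

lemma target_right:
  "target a c e g h i j k l =
    (Interval (L a (L c k), L a (L c l)),
     Interval (L (R a (L i e)) (R i e), L (R a (L j e)) (R j e)),
     Interval (R (R g c) e, R (R h c) e))"
  by (simp add: target_def braid_mid)

text \<open>The box \<open>?B\<close> of summation indices parametrizes injectively, through
  \<open>?\<phi>\<close>, a set containing all nonzero paths; this set serves as \<open>T\<close> in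
  \<open>lookup_left_composite\<close>.\<close>

lemma left_composite_eq_sum:
  fixes r :: "('x, 'k::field) DD \<Rightarrow> ('x, 'k) DD"
  assumes supp: "supported (\<lambda>I J P Q. Poly_Mapping.lookup (r (bas (I, J))) (P, Q))"
    and le: "a \<le> g" "g \<le> h" "h \<le> b" "c \<le> i" "i \<le> j" "j \<le> d" "e \<le> k" "k \<le> l" "l \<le> f"
  shows "Poly_Mapping.lookup (braid_left r (braid_right r (braid_left r
      (bas (Interval (a, b), Interval (c, d), Interval (e, f)))))) (target a c e g h i j k l) =
    left_sum (coeff r) a b c d e f g h i j k l"
proof -
  let ?M = "\<lambda>I J P Q. Poly_Mapping.lookup (r (bas (I, J))) (P, Q)"
  let ?I = "Interval (a, b)" and ?J = "Interval (c, d)" and ?K = "Interval (e, f)"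
  let ?I' = "Interval (L a (L c k), L a (L c l))"
  let ?J' = "Interval (R (L a i) (L (R a i) e), R (L a j) (L (R a j) e))"
  let ?K' = "Interval (R (R g c) e, R (R h c) e)"
  let ?B = "{a..g} \<times> {h..b} \<times> {c..i} \<times> {j..d} \<times> {e..k} \<times> {l..f}"
  let ?\<phi> = "\<lambda>(x, y, w, z, u, v). (Interval (L a w, L a z), Interval (R x c, R y c),
    Interval (L (R x c) u, L (R x c) v))"
  have abc: "a \<le> b" "c \<le> d" "e \<le> f"
    using le by (meson order_trans)+
  have ordered: "x \<le> y" "w \<le> z" "u \<le> v" if "(x, y, w, z, u, v) \<in> ?B" for x y w z u v
    using that le by (auto intro: order_trans)
  \<comment> \<open>Needed for the guard in \<open>coeff\<close>, which returns \<open>0\<close> at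
    unordered indices.\<close>
  have mid: "R (L a i) (L (R a i) e) \<le> R (L a j) (L (R a j) e)"
    using le mid_left[of c i a e] mid_left[of c j a e] by (simp add: L_mono R_mono)
  have inj: "inj_on ?\<phi> ?B"
  proof (rule inj_onI)
    fix s t assume st: "s \<in> ?B" "t \<in> ?B" "?\<phi> s = ?\<phi> t"
    obtain x y w z u v where s: "s = (x, y, w, z, u, v)" by (metis prod_cases6)
    obtain x' y' w' z' u' v' where t: "t = (x', y', w', z', u', v')" by (metis prod_cases6)
    show "s = t"
      using st(3) ordered[OF st(1)[unfolded s]] ordered[OF st(2)[unfolded t]]
      by (auto simp: s t Interval_eq_iff L_mono R_mono)
  qed
  \<comment> \<open>\<open>left_support\<close> yields its own six points. Having the same target,
    they agree with \<open>g, h, i, j, k, l\<close>, and its inequalities then put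
    \<open>(x, y, w, z, u, v)\<close> into the box.\<close>
  have supp_sub: "(P, Q, S) \<in> ?\<phi> ` ?B"
    if nz: "?M ?I ?J P Q \<noteq> 0" "?M Q ?K S ?K' \<noteq> 0" "?M P S ?I' ?J' \<noteq> 0" for P Q S
  proof (rule left_support[OF supp nz, of a c e])
    fix x y w z u v g' h' i' j' k' l'
    assume *: "a \<le> x" "x \<le> g'" "g' \<le> h'" "h' \<le> y" "y \<le> upper ?I"
      "c \<le> w" "w \<le> i'" "i' \<le> j'" "j' \<le> z" "z \<le> upper ?J"
      "e \<le> u" "u \<le> k'" "k' \<le> l'" "l' \<le> v" "v \<le> upper ?K"
      and PQS: "P = Interval (L a w, L a z)" "Q = Interval (R x c, R y c)"
        "S = Interval (L (R x c) u, L (R x c) v)"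
      and t: "?I' = Interval (L a (L c k'), L a (L c l'))"
        "?J' = Interval (R (L a i') (L (R a i') e), R (L a j') (L (R a j') e))"
        "?K' = Interval (R (R g' c) e, R (R h' c) e)"
    have "target a c e g h i j k l = target a c e g' h' i' j' k' l'"
      unfolding target_def t ..
    then have "g = g' \<and> h = h' \<and> i = i' \<and> j = j' \<and> k = k' \<and> l = l'"
      using target_eq_iff[OF le(4) order_trans[OF *(6,7)] le(2,5,8) *(3,8,13)] by blast
    then show ?thesis
      using * abc unfolding PQS by (intro image_eqI[of _ _ "(x, y, w, z, u, v)"]) auto
  qed (use abc in simp_all)
  have fin: "finite (?\<phi> ` ?B)"
    by (intro finite_imageI finite_cartesian_product finite_closed_interval)
  have "Poly_Mapping.lookup (braid_left r (braid_right r (braid_left r (bas (?I, ?J, ?K)))))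
      (target a c e g h i j k l) = (\<Sum>(P, Q, S)\<in>?\<phi> ` ?B. ?M ?I ?J P Q * ?M Q ?K S ?K' * ?M P S ?I' ?J')"
    unfolding target_def by (rule lookup_left_composite[OF fin]) (rule supp_sub)
  also have "\<dots> = (\<Sum>(x, y, w, z, u, v)\<in>?B.
      coeff r (a, b, c, d) (L a w, L a z, R x c, R y c) *
      coeff r (R x c, R y c, e, f) (L (R x c) u, L (R x c) v, R (R g c) e, R (R h c) e) *
      coeff r (L a w, L a z, L (R x c) u, L (R x c) v)
        (L a (L c k), L a (L c l), R (L a i) (L (R a i) e), R (L a j) (L (R a j) e)))"
    unfolding sum.reindex[OF inj]
  proof (rule sum.cong[OF refl])
    fix t assume t: "t \<in> ?B"
    obtain x y w z u v where t': "t = (x, y, w, z, u, v)" by (metis prod_cases6)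
    note o = ordered[OF t[unfolded t']]
    show "((\<lambda>(P, Q, S). ?M ?I ?J P Q * ?M Q ?K S ?K' * ?M P S ?I' ?J') \<circ> ?\<phi>) t =
      (case t of (x, y, w, z, u, v) \<Rightarrow>
      coeff r (a, b, c, d) (L a w, L a z, R x c, R y c) *
      coeff r (R x c, R y c, e, f) (L (R x c) u, L (R x c) v, R (R g c) e, R (R h c) e) *
      coeff r (L a w, L a z, L (R x c) u, L (R x c) v)
        (L a (L c k), L a (L c l), R (L a i) (L (R a i) e), R (L a j) (L (R a j) e)))"
      using o abc le mid by (simp add: t' coeff_def L_mono R_mono)
  qed
  also have "\<dots> = left_sum (coeff r) a b c d e f g h i j k l"
    unfolding left_sum_def by (simp add: sum.cartesian_product')
  finally show ?thesis .
qed

lemma right_composite_eq_sum: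
  fixes r :: "('x, 'k::field) DD \<Rightarrow> ('x, 'k) DD"
  assumes supp: "supported (\<lambda>I J P Q. Poly_Mapping.lookup (r (bas (I, J))) (P, Q))"
    and le: "a \<le> g" "g \<le> h" "h \<le> b" "c \<le> i" "i \<le> j" "j \<le> d" "e \<le> k" "k \<le> l" "l \<le> f"
  shows "Poly_Mapping.lookup (braid_right r (braid_left r (braid_right r
      (bas (Interval (a, b), Interval (c, d), Interval (e, f)))))) (target a c e g h i j k l) =
    right_sum (coeff r) a b c d e f g h i j k l"
proof -
  let ?M = "\<lambda>I J P Q. Poly_Mapping.lookup (r (bas (I, J))) (P, Q)"
  let ?I = "Interval (a, b)" and ?J = "Interval (c, d)" and ?K = "Interval (e, f)"
  let ?I' = "Interval (L a (L c k), L a (L c l))"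
  let ?J' = "Interval (L (R a (L i e)) (R i e), L (R a (L j e)) (R j e))"
  let ?K' = "Interval (R (R g c) e, R (R h c) e)"
  let ?B = "{a..g} \<times> {h..b} \<times> {c..i} \<times> {j..d} \<times> {e..k} \<times> {l..f}"
  let ?\<phi> = "\<lambda>(x, y, w, z, u, v). (Interval (L c u, L c v), Interval (R w e, R z e),
    Interval (R x (L c u), R y (L c u)))"
  have abc: "a \<le> b" "c \<le> d" "e \<le> f"
    using le by (meson order_trans)+
  have ordered: "x \<le> y" "w \<le> z" "u \<le> v" if "(x, y, w, z, u, v) \<in> ?B" for x y w z u v
    using that le by (auto intro: order_trans)
  have mid: "L (R a (L i e)) (R i e) \<le> L (R a (L j e)) (R j e)"
    using le mid_right[of c i a e] mid_right[of c j a e] by (simp add: L_mono R_mono)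
  have inj: "inj_on ?\<phi> ?B"
  proof (rule inj_onI)
    fix s t assume st: "s \<in> ?B" "t \<in> ?B" "?\<phi> s = ?\<phi> t"
    obtain x y w z u v where s: "s = (x, y, w, z, u, v)" by (metis prod_cases6)
    obtain x' y' w' z' u' v' where t: "t = (x', y', w', z', u', v')" by (metis prod_cases6)
    show "s = t"
      using st(3) ordered[OF st(1)[unfolded s]] ordered[OF st(2)[unfolded t]]
      by (auto simp: s t Interval_eq_iff L_mono R_mono)
  qed
  have supp_sub: "(U, V, W) \<in> ?\<phi> ` ?B"
    if nz: "?M ?J ?K U V \<noteq> 0" "?M ?I U ?I' W \<noteq> 0" "?M W V ?J' ?K' \<noteq> 0" for U V W
  proof (rule right_support[OF supp nz, of a c e])
    fix x y w z u v g' h' i' j' k' l'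
    assume *: "a \<le> x" "x \<le> g'" "g' \<le> h'" "h' \<le> y" "y \<le> upper ?I"
      "c \<le> w" "w \<le> i'" "i' \<le> j'" "j' \<le> z" "z \<le> upper ?J"
      "e \<le> u" "u \<le> k'" "k' \<le> l'" "l' \<le> v" "v \<le> upper ?K"
      and UVW: "U = Interval (L c u, L c v)" "V = Interval (R w e, R z e)"
        "W = Interval (R x (L c u), R y (L c u))"
      and t: "?I' = Interval (L a (L c k'), L a (L c l'))"
        "?J' = Interval (L (R a (L i' e)) (R i' e), L (R a (L j' e)) (R j' e))"
        "?K' = Interval (R (R g' c) e, R (R h' c) e)"
    have "target a c e g h i j k l = target a c e g' h' i' j' k' l'"
      unfolding target_right t ..
    then have "g = g' \<and> h = h' \<and> i = i' \<and> j = j' \<and> k = k' \<and> l = l'"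
      using target_eq_iff[OF le(4) order_trans[OF *(6,7)] le(2,5,8) *(3,8,13)] by blast
    then show ?thesis
      using * abc unfolding UVW by (intro image_eqI[of _ _ "(x, y, w, z, u, v)"]) auto
  qed (use abc in simp_all)
  have fin: "finite (?\<phi> ` ?B)"
    by (intro finite_imageI finite_cartesian_product finite_closed_interval)
  have "Poly_Mapping.lookup (braid_right r (braid_left r (braid_right r (bas (?I, ?J, ?K)))))
      (target a c e g h i j k l) = (\<Sum>(U, V, W)\<in>?\<phi> ` ?B. ?M ?J ?K U V * ?M ?I U ?I' W * ?M W V ?J' ?K')"
    unfolding target_right by (rule lookup_right_composite[OF fin]) (rule supp_sub)
  also have "\<dots> = (\<Sum>(x, y, w, z, u, v)\<in>?B.
      coeff r (c, d, e, f) (L c u, L c v, R w e, R z e) *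
      coeff r (a, b, L c u, L c v) (L a (L c k), L a (L c l), R x (L c u), R y (L c u)) *
      coeff r (R x (L c u), R y (L c u), R w e, R z e)
        (L (R a (L i e)) (R i e), L (R a (L j e)) (R j e), R (R g c) e, R (R h c) e))"
    unfolding sum.reindex[OF inj]
  proof (rule sum.cong[OF refl])
    fix t assume t: "t \<in> ?B"
    obtain x y w z u v where t': "t = (x, y, w, z, u, v)" by (metis prod_cases6)
    note o = ordered[OF t[unfolded t']]
    show "((\<lambda>(U, V, W). ?M ?J ?K U V * ?M ?I U ?I' W * ?M W V ?J' ?K') \<circ> ?\<phi>) t =
      (case t of (x, y, w, z, u, v) \<Rightarrow>
      coeff r (c, d, e, f) (L c u, L c v, R w e, R z e) *
      coeff r (a, b, L c u, L c v) (L a (L c k), L a (L c l), R x (L c u), R y (L c u)) *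
      coeff r (R x (L c u), R y (L c u), R w e, R z e)
        (L (R a (L i e)) (R i e), L (R a (L j e)) (R j e), R (R g c) e, R (R h c) e))"
      using o abc le mid by (simp add: t' coeff_def L_mono R_mono)
  qed
  also have "\<dots> = right_sum (coeff r) a b c d e f g h i j k l"
    unfolding right_sum_def by (simp add: sum.cartesian_product')
  finally show ?thesis .
qed

lemma composite_nonzeroE:
  fixes r :: "('x, 'k::field) DD \<Rightarrow> ('x, 'k) DD"
  assumes supp: "supported (\<lambda>I J P Q. Poly_Mapping.lookup (r (bas (I, J))) (P, Q))"
    and nz: "Poly_Mapping.lookup (braid_left r (braid_right r (braid_left r (bas (I, J, K))))) t \<noteq> 0 \<or>
      Poly_Mapping.lookup (braid_right r (braid_left r (braid_right r (bas (I, J, K))))) t \<noteq> 0"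
  obtains g h i j k l where "lower I \<le> g" "g \<le> h" "h \<le> upper I" "lower J \<le> i" "i \<le> j" "j \<le> upper J"
    "lower K \<le> k" "k \<le> l" "l \<le> upper K" "t = target (lower I) (lower J) (lower K) g h i j k l"
proof -
  obtain I' J' K' where t: "t = (I', J', K')" by (metis prod_cases3)
  from nz show thesis
  proof
    assume "Poly_Mapping.lookup (braid_left r (braid_right r (braid_left r (bas (I, J, K))))) t \<noteq> 0"
    \<comment> \<open>If no path had nonzero weight, \<open>T = {}\<close> would be admissible in
      \<open>lookup_left_composite\<close> and the coefficient would vanish.\<close>
    then obtain P Q S where *: "Poly_Mapping.lookup (r (bas (I, J))) (P, Q) \<noteq> 0"
      "Poly_Mapping.lookup (r (bas (Q, K))) (S, K') \<noteq> 0" "Poly_Mapping.lookup (r (bas (P, S))) (I', J') \<noteq> 0"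
      using lookup_left_composite[of "{}" r I J K K' I' J'] by (auto simp: t)
    show thesis
      by (rule left_support[OF supp * refl refl refl], rule that)
        (auto simp: t target_def intro: order_trans)
  next
    assume "Poly_Mapping.lookup (braid_right r (braid_left r (braid_right r (bas (I, J, K))))) t \<noteq> 0"
    then obtain U V W where *: "Poly_Mapping.lookup (r (bas (J, K))) (U, V) \<noteq> 0"
      "Poly_Mapping.lookup (r (bas (I, U))) (I', W) \<noteq> 0" "Poly_Mapping.lookup (r (bas (W, V))) (J', K') \<noteq> 0"
      using lookup_right_composite[of "{}" r J K I I' J' K'] by (auto simp: t)
    show thesis
      by (rule right_support[OF supp * refl refl refl], rule that)
        (auto simp: t target_right intro: order_trans)
  qed
qed

text \<open>The sums are the coefficients at the targets. Elsewhere both composites vanish by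
  \<open>composite_nonzeroE\<close>, so agreement at the targets suffices.\<close>

lemma lin_braid_iff_sums:
  fixes r :: "('x, 'k::field) DD \<Rightarrow> ('x, 'k) DD"
  assumes supp: "supported (\<lambda>I J P Q. Poly_Mapping.lookup (r (bas (I, J))) (P, Q))"
  shows "lin_braid r \<longleftrightarrow> (\<forall>a b c d e f g h i j k l.
    a \<le> g \<longrightarrow> g \<le> h \<longrightarrow> h \<le> b \<longrightarrow> c \<le> i \<longrightarrow> i \<le> j \<longrightarrow> j \<le> d \<longrightarrow> e \<le> k \<longrightarrow> k \<le> l \<longrightarrow> l \<le> f \<longrightarrow>
    left_sum (coeff r) a b c d e f g h i j k l = right_sum (coeff r) a b c d e f g h i j k l)"
    (is "_ \<longleftrightarrow> ?rhs")
proof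
  assume braid: "lin_braid r"
  show ?rhs
  proof (intro allI impI)
    fix a b c d e f g h i j k l :: 'x
    assume le: "a \<le> g" "g \<le> h" "h \<le> b" "c \<le> i" "i \<le> j" "j \<le> d" "e \<le> k" "k \<le> l" "l \<le> f"
    show "left_sum (coeff r) a b c d e f g h i j k l = right_sum (coeff r) a b c d e f g h i j k l"
      unfolding left_composite_eq_sum[OF supp le, symmetric] right_composite_eq_sum[OF supp le, symmetric]
      unfolding target_def by (rule lin_braid_iff[THEN iffD1, OF braid, rule_format])
  qed
next
  assume sums: ?rhs
  show "lin_braid r"
    unfolding lin_braid_iff
  proof (intro allI, rule ccontr)
    fix I J K I' J' K'
    let ?l = "Poly_Mapping.lookup (braid_left r (braid_right r (braid_left r (bas (I, J, K))))) (I', J', K')"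
    let ?r = "Poly_Mapping.lookup (braid_right r (braid_left r (braid_right r (bas (I, J, K))))) (I', J', K')"
    assume ne: "?l \<noteq> ?r"
    then have "?l \<noteq> 0 \<or> ?r \<noteq> 0" by auto
    from composite_nonzeroE[OF supp this] obtain g h i j k l where le:
      "lower I \<le> g" "g \<le> h" "h \<le> upper I" "lower J \<le> i" "i \<le> j" "j \<le> upper J"
      "lower K \<le> k" "k \<le> l" "l \<le> upper K"
      and t: "(I', J', K') = target (lower I) (lower J) (lower K) g h i j k l"
      by blast
    have "?l = ?r"
      using left_composite_eq_sum[OF supp le] right_composite_eq_sum[OF supp le] sums le
      by (simp flip: t)
    with ne show False by simp
  qed
qed

end

section \<open>From the automorphism to its order braiding\<close>

lemma (in order_braiding) supported_lookup:
  assumes "coalgebra_automorphism r" "induced_map r = s"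
  shows "supported (\<lambda>I J P Q. Poly_Mapping.lookup (r (bas (I, J))) (P, Q))"
proof -
  interpret M: incidence_matrix "coeff_matrix r"
    using assms(1) by (rule incidence_matrix_coeff_matrix)
  have s: "M.grouplike_map = s"
    using induced_map_eq_grouplike_map[OF assms(1)] assms(2) by simp
  show ?thesis
    unfolding supported_def
  proof (intro allI impI)
    fix I J P Q
    assume "Poly_Mapping.lookup (r (bas (I, J))) (P, Q) \<noteq> 0"
    then have "coeff_matrix r (lower I, lower J) (upper I, upper J) (lower P, lower Q) (upper P, upper Q) \<noteq> 0"
      by (simp add: coeff_matrix_def)
    then obtain D F where DF: "(lower I, lower J) \<le> D" "D \<le> F" "F \<le> (upper I, upper J)"
      "(lower P, lower Q) = s D" "(upper P, upper Q) = s F"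
      using M.support[of "(lower I, lower J)" "(upper I, upper J)" "(lower P, lower Q)" "(upper P, upper Q)"]
      unfolding s by auto
    obtain x w where D: "D = (x, w)" by fastforce
    obtain y z where F: "F = (y, z)" by fastforce
    have le: "lower I \<le> x" "x \<le> y" "y \<le> upper I" "lower J \<le> w" "w \<le> z" "z \<le> upper J"
      using DF(1-3) by (auto simp: D F)
    have "lower I \<le> y" "lower J \<le> z"
      using le by (auto intro: order_trans)
    \<comment> \<open>\<open>M.support\<close> gives the ends as \<open>s (x, w)\<close> and
      \<open>s (y, z)\<close>; \<open>L_const\<close> moves \<open>x\<close>, \<open>y\<close> down
      to \<open>lower I\<close>, and \<open>R_const\<close> moves \<open>w\<close>, \<open>z\<close>
      down to \<open>lower J\<close>.\<close>
    then have "lower P = L (lower I) w" "upper P = L (lower I) z"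
      "lower Q = R x (lower J)" "upper Q = R y (lower J)"
      using arg_cong[OF DF(4), of fst] arg_cong[OF DF(5), of fst] arg_cong[OF DF(4), of snd]
        arg_cong[OF DF(5), of snd] L_const[of "lower I" x] L_const[of "lower I" y]
        R_const[of "lower J" w] R_const[of "lower J" z] le
      by (simp_all add: D F)
    with le show "\<exists>x y w z. lower I \<le> x \<and> x \<le> y \<and> y \<le> upper I \<and> lower J \<le> w \<and> w \<le> z \<and> z \<le> upper J \<and>
      lower P = L (lower I) w \<and> upper P = L (lower I) z \<and>
      lower Q = R x (lower J) \<and> upper Q = R y (lower J)"
      by (intro exI[of _ x] exI[of _ y] exI[of _ w] exI[of _ z]) simp
  qed
qed

theorem proposition4p3:
  fixes r :: "('x::locally_finite_order interval \<times> 'x interval \<Rightarrow>\<^sub>0 'k::field) \<Rightarrow>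
              ('x interval \<times> 'x interval \<Rightarrow>\<^sub>0 'k)"
  assumes "coalgebra_automorphism r"
    and "nondegenerate r"
    and "set_nondegenerate (induced_map r)"
    and "set_braid (induced_map r)"
  shows "lin_braid r \<longleftrightarrow>
    (let L = (\<lambda>a c. fst (induced_map r (a, c)));
         R = (\<lambda>a c. snd (induced_map r (a, c)));
         lam = coeff r
     in \<forall>a b c d e f g h i j k l.
       a \<le> b \<longrightarrow> c \<le> d \<longrightarrow> e \<le> f \<longrightarrow> g \<le> h \<longrightarrow> i \<le> j \<longrightarrow> k \<le> l \<longrightarrow>
       {g..h} \<subseteq> {a..b} \<longrightarrow> {i..j} \<subseteq> {c..d} \<longrightarrow> {k..l} \<subseteq> {e..f} \<longrightarrow>
       (\<Sum>x\<in>{a..g}. \<Sum>y\<in>{h..b}. \<Sum>w\<in>{c..i}. \<Sum>z\<in>{j..d}. \<Sum>u\<in>{e..k}. \<Sum>v\<in>{l..f}.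
          lam (a, b, c, d) (L a w, L a z, R x c, R y c) *
          lam (R x c, R y c, e, f)
              (L (R x c) u, L (R x c) v, R (R g c) e, R (R h c) e) *
          lam (L a w, L a z, L (R x c) u, L (R x c) v)
              (L a (L c k), L a (L c l), R (L a i) (L (R a i) e), R (L a j) (L (R a j) e)))
       =
       (\<Sum>x\<in>{a..g}. \<Sum>y\<in>{h..b}. \<Sum>w\<in>{c..i}. \<Sum>z\<in>{j..d}. \<Sum>u\<in>{e..k}. \<Sum>v\<in>{l..f}.
          lam (c, d, e, f) (L c u, L c v, R w e, R z e) *
          lam (a, b, L c u, L c v)
              (L a (L c k), L a (L c l), R x (L c u), R y (L c u)) *
          lam (R x (L c u), R y (L c u), R w e, R z e)
              (L (R a (L i e)) (R i e), L (R a (L j e)) (R j e), R (R g c) e, R (R h c) e)))"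
proof -
  interpret M: incidence_matrix_pair "coeff_matrix r" "coeff_matrix (inv r)"
    using assms(1) by (rule incidence_matrix_pair_coeff_matrix)
  note induced = induced_map_eq_grouplike_map[OF assms(1)]
  interpret order_braiding "induced_map r"
    using assms(3,4) M.grouplike_map_le_iff M.bij_grouplike_map
    by unfold_locales (simp_all add: induced)
  have supp: "supported (\<lambda>I J P Q. Poly_Mapping.lookup (r (bas (I, J))) (P, Q))"
    by (rule supported_lookup[OF assms(1) refl])
  \<comment> \<open>For \<open>g \<le> h\<close> the interval \<open>[g, h]\<close> is nonempty, so
    its containment in \<open>[a, b]\<close> means \<open>a \<le> g\<close> and
    \<open>h \<le> b\<close>; likewise for the other two pairs.\<close>
  have guards: "(a \<le> b \<longrightarrow> c \<le> d \<longrightarrow> e \<le> f \<longrightarrow> g \<le> h \<longrightarrow> i \<le> j \<longrightarrow> k \<le> l \<longrightarrow>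
       {g..h} \<subseteq> {a..b} \<longrightarrow> {i..j} \<subseteq> {c..d} \<longrightarrow> {k..l} \<subseteq> {e..f} \<longrightarrow> \<Phi>) \<longleftrightarrow>
     (a \<le> g \<longrightarrow> g \<le> h \<longrightarrow> h \<le> b \<longrightarrow> c \<le> i \<longrightarrow> i \<le> j \<longrightarrow> j \<le> d \<longrightarrow> e \<le> k \<longrightarrow> k \<le> l \<longrightarrow> l \<le> f \<longrightarrow> \<Phi>)"
    for a b c d e f g h i j k l :: 'x and \<Phi>
    using order_trans[of a g b] order_trans[of g h b] order_trans[of c i d] order_trans[of i j d]
      order_trans[of e k f] order_trans[of k l f] by auto
  show ?thesis
    unfolding Let_def guards lin_braid_iff_sums[OF supp] left_sum_def right_sum_def ..
qed

end
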